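(* For every $n \geq 6$ there exists an irreducible valuation $v \in \mathcal{GSV}_n$ which does not belong to the smallest subset of $\mathcal{GSV}_n$ that contains all weighted ranks of matroids and all partition valuations whose ground sets are subsets of $[n]$ and that is closed under merging and endowment.
   Context: Let $[n]=\{1,\dots,n\}$. A valuation with ground set $E \subseteq [n]$ is a function $u: 2^E \to \mathbb{R}_{\geq 0}$ with $u(\emptyset)=0$ and $u(S)\le u(T)$ whenever $S \subseteq T$; two valuations are equal only if they have the same ground set and agree everywhere. For $p \in \mathbb{R}^E$ let $D(u,p)=\arg\max_{S \subseteq E}\big(u(S)-\sum_{i\in S}p_i\big)$; $u$ is gross substitutes if for all $p \le q$ in $\mathbb{R}^E$ and every $S \in D(u,p)$ there is $T \in D(u,q)$ with $\{i \in S: p_i=q_i\}\subseteq T$. $\mathcal{GSV}_n$ is the set of gross substitutes valuations whose ground set is a subset of $[n]$. Merging: for valuations $u^1$ on $E^1$ and $u^2$ on $E^2$, $(u^1\ast u^2)(S)=\max\{u^1(T)+u^2(S\setminus T): T \subseteq S\cap E^1,\ S\setminus T \subseteq E^2\}$ for $S\subseteq E^1\cup E^2$. Endowment: for $u$ on $E$ and $T\subseteq E$, $\partial^T u(S)=u(S\cup T)-u(T)$ for $S\subseteq E\setminus T$. A valuation $v\in\mathcal{GSV}_n$ is irreducible if $v=u\ast u'$ with $u,u'\in\mathcal{GSV}_n$ implies $v=u$ or $v=u'$. The weighted rank of a matroid on $E$ with independent sets $\mathcal{I}$ and weights $w\in\mathbb{R}^E_{\ge0}$ is $\rho^w(T)=\max\{\sum_{i\in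 I}w_i: I\in\mathcal{I}, I\subseteq T\}$. For a set partition $\pi=\{\pi_1,\dots,\pi_m\}$ of a set $S$ and reals $0<a<b<2a$, the partition valuation $v^{\pi,a,b}$ on $S$ is given by $v(\emptyset)=0$, $v(I)=a$ if $\emptyset\ne I\subseteq\pi_r$ for some $r$, and $v(I)=b$ otherwise. *)

theory Defs
  imports Complex_Main "HOL-Library.FuncSet" "HOL-Library.Disjoint_Sets"
begin

text \<open>
  A valuation is a pair of its ground set \<open>E\<close> and a set function that is extensional on
  \<open>Pow E\<close>, so that HOL equality of pairs is equality of ground sets and of all values on
  subsets of \<open>E\<close>.
\<close>

type_synonym setfun = "nat set \<times> (nat set \<Rightarrow> real)"

definition valuation_on :: "nat set \<Rightarrow> (nat set \<Rightarrow> real) \<Rightarrow> bool" where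
  "valuation_on E u \<longleftrightarrow>
     u \<in> Pow E \<rightarrow>\<^sub>E {0..} \<and> u {} = 0 \<and> (\<forall>S T. S \<subseteq> T \<and> T \<subseteq> E \<longrightarrow> u S \<le> u T)"

text \<open>
  Price vectors in \<open>\<real>\<^sup>E\<close> are total functions; only their values on \<open>E\<close> are ever used.
\<close>

definition demand :: "nat set \<Rightarrow> (nat set \<Rightarrow> real) \<Rightarrow> (nat \<Rightarrow> real) \<Rightarrow> nat set set" where
  "demand E u p = {S. is_arg_max (\<lambda>S. u S - (\<Sum>i\<in>S. p i)) (\<lambda>S. S \<subseteq> E) S}"

definition gross_substitutes :: "nat set \<Rightarrow> (nat set \<Rightarrow> real) \<Rightarrow> bool" where
  "gross_substitutes E u \<longleftrightarrow>
     (\<forall>p q. (\<forall>i\<in>E. p i \<le> q i) \<longrightarrow>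
       (\<forall>S\<in>demand E u p. \<exists>T\<in>demand E u q. {i\<in>S. p i = q i} \<subseteq> T))"

definition GSV :: "nat \<Rightarrow> setfun set" where
  "GSV n = {(E, u). E \<subseteq> {1..n} \<and> valuation_on E u \<and> gross_substitutes E u}"

fun merge :: "setfun \<Rightarrow> setfun \<Rightarrow> setfun" where
  "merge (E1, u1) (E2, u2) =
     (E1 \<union> E2,
      \<lambda>S\<in>Pow (E1 \<union> E2). Max {u1 T + u2 (S - T) | T. T \<subseteq> S \<inter> E1 \<and> S - T \<subseteq> E2})"

fun endow :: "nat set \<Rightarrow> setfun \<Rightarrow> setfun" where
  "endow T (E, u) = (E - T, \<lambda>S\<in>Pow (E - T). u (S \<union> T) - u T)"

definition irreducible_valuation :: "nat \<Rightarrow> setfun \<Rightarrow> bool" where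
  "irreducible_valuation n v \<longleftrightarrow>
     v \<in> GSV n \<and> (\<forall>u\<in>GSV n. \<forall>u'\<in>GSV n. v = merge u u' \<longrightarrow> v = u \<or> v = u')"

definition matroid :: "nat set \<Rightarrow> nat set set \<Rightarrow> bool" where
  "matroid E \<I> \<longleftrightarrow>
     finite E \<and> \<I> \<subseteq> Pow E \<and> {} \<in> \<I> \<and>
     (\<forall>I\<in>\<I>. \<forall>J. J \<subseteq> I \<longrightarrow> J \<in> \<I>) \<and>
     (\<forall>I\<in>\<I>. \<forall>J\<in>\<I>. card I < card J \<longrightarrow> (\<exists>x\<in>J - I. insert x I \<in> \<I>))"

definition weighted_rank :: "nat set \<Rightarrow> nat set set \<Rightarrow> (nat \<Rightarrow> real) \<Rightarrow> setfun" where
  "weighted_rank E \<I> w = (E, \<lambda>T\<in>Pow E. Max {\<Sum>i\<in>I. w i | I. I \<in> \<I> \<and> I \<subseteq> T})"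

definition weighted_ranks :: "nat \<Rightarrow> setfun set" where
  "weighted_ranks n =
     {weighted_rank E \<I> w | E \<I> w. E \<subseteq> {1..n} \<and> matroid E \<I> \<and> (\<forall>i\<in>E. 0 \<le> w i)}"

definition partition_valuation :: "nat set \<Rightarrow> nat set set \<Rightarrow> real \<Rightarrow> real \<Rightarrow> setfun" where
  "partition_valuation S \<pi> a b =
     (S, \<lambda>I\<in>Pow S. if I = {} then 0 else if \<exists>B\<in>\<pi>. I \<subseteq> B then a else b)"

definition partition_valuations :: "nat \<Rightarrow> setfun set" where
  "partition_valuations n =
     {partition_valuation S \<pi> a b | S \<pi> a b.
        S \<subseteq> {1..n} \<and> partition_on S \<pi> \<and> 0 < a \<and> a < b \<and> b < 2 * a}"

definition closed_under_merging :: "setfun set \<Rightarrow> bool" where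
  "closed_under_merging X \<longleftrightarrow> (\<forall>u\<in>X. \<forall>u'\<in>X. merge u u' \<in> X)"

definition closed_under_endowment :: "setfun set \<Rightarrow> bool" where
  "closed_under_endowment X \<longleftrightarrow> (\<forall>u\<in>X. \<forall>T. T \<subseteq> fst u \<longrightarrow> endow T u \<in> X)"

definition generated_valuations :: "nat \<Rightarrow> setfun set" where
  "generated_valuations n =
     \<Inter> {X. X \<subseteq> GSV n \<and> weighted_ranks n \<subseteq> X \<and> partition_valuations n \<subseteq> X \<and>
             closed_under_merging X \<and> closed_under_endowment X}"

end

theory Submission imports Defs begin

text \<open>
  Colour \<open>{1..n}\<close> by the classes \<open>{1,2}\<close>, \<open>{3,4}\<close>, \<open>{5..n}\<close> and let \<open>v S\<close> be 0, 3, 5 or 6 if \<open>S\<close>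
  meets 0, 1, 2 or 3 classes. If \<open>v = u * u'\<close>, then, since pairs are worth less than 6, one factor
  values all singletons at 3. Every item has a parallel partner, so the other factor vanishes on
  singletons and hence everywhere. Since \<open>v\<close> lives on the full ground set, it is not a proper
  endowment either, and it is neither a weighted rank nor a partition valuation; thus
  \<open>GSV n - {v}\<close> is a closed family as soon as \<open>GSV n\<close> is one.

  Ranks and partition valuations satisfy the exchange property of M-natural-concave functions,
  which implies gross substitutes. A merge is obtained from a direct sum on two copies of the
  items by identifying the copies one pair at a time, and each such step preserves gross
  substitutes.
\<close>

section \<open>Demand and gross substitutes over an arbitrary type of items\<close>

text \<open>Items have an arbitrary type because merging is derived on a disjoint union of two
  copies of the ground set, whose items are no longer natural numbers.\<close>

definition demanded :: "'a set \<Rightarrow> ('a set \<Rightarrow> real) \<Rightarrow> ('a \<Rightarrow> real) \<Rightarrow> 'a set set" where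
  "demanded E u p = {S. S \<subseteq> E \<and> (\<forall>T\<subseteq>E. u T - sum p T \<le> u S - sum p S)}"

definition gs :: "'a set \<Rightarrow> ('a set \<Rightarrow> real) \<Rightarrow> bool" where
  "gs E u \<longleftrightarrow> (\<forall>p q. (\<forall>i\<in>E. p i \<le> q i) \<longrightarrow>
     (\<forall>S\<in>demanded E u p. \<exists>T\<in>demanded E u q. {i\<in>S. p i = q i} \<subseteq> T))"

lemma gross_substitutes_iff_gs: "gross_substitutes E u \<longleftrightarrow> gs E u"
proof -
  have "demand E u = demanded E u"
    by (auto simp: fun_eq_iff demand_def demanded_def is_arg_max_def not_less)
  then show ?thesis by (simp add: gross_substitutes_def gs_def)
qed

lemma demandedI:
  assumes "S \<subseteq> E" "\<And>T. T \<subseteq> E \<Longrightarrow> u T - sum p T \<le> u S - sum p S"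
  shows "S \<in> demanded E u p"
  using assms by (auto simp: demanded_def)

lemma demandedD:
  assumes "S \<in> demanded E u p"
  shows "S \<subseteq> E" "\<And>T. T \<subseteq> E \<Longrightarrow> u T - sum p T \<le> u S - sum p S"
  using assms by (auto simp: demanded_def)

lemma demanded_nonempty:
  assumes "finite E"
  shows "\<exists>S. S \<in> demanded E u p"
proof -
  have fin: "finite ((\<lambda>S. u S - sum p S) ` Pow E)" using assms by simp
  have "(\<lambda>S. u S - sum p S) ` Pow E \<noteq> {}" by auto
  from Max_in[OF fin this] obtain S where S: "S \<subseteq> E"
    "u S - sum p S = Max ((\<lambda>S. u S - sum p S) ` Pow E)" by auto
  then have "S \<in> demanded E u p"
    using fin by (intro demandedI) auto
  then show ?thesis by blast
qed

lemma gsD: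
  assumes "gs E u" "\<And>i. i \<in> E \<Longrightarrow> p i \<le> q i" "S \<in> demanded E u p"
  obtains T where "T \<in> demanded E u q" "{i\<in>S. p i = q i} \<subseteq> T"
  using assms unfolding gs_def by blast

lemma gsI:
  assumes "\<And>p q S. \<lbrakk>\<And>i. i \<in> E \<Longrightarrow> p i \<le> q i; S \<in> demanded E u p\<rbrakk>
             \<Longrightarrow> \<exists>T\<in>demanded E u q. {i\<in>S. p i = q i} \<subseteq> T"
  shows "gs E u"
  using assms unfolding gs_def by blast

lemma demanded_cong:
  assumes "\<And>S. S \<subseteq> E \<Longrightarrow> u S = u' S"
  shows "demanded E u = demanded E u'"
  using assms by (auto simp: demanded_def fun_eq_iff)

lemma gs_cong:
  assumes "\<And>S. S \<subseteq> E \<Longrightarrow> u S = u' S"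
  shows "gs E u \<longleftrightarrow> gs E u'"
  unfolding gs_def using demanded_cong[of E u u', OF assms] by simp

text \<open>Raising the price of \<open>x\<close> leaves exactly the demanded sets that avoid \<open>x\<close>.\<close>

lemma gs_drop_item:
  assumes "finite E" "gs E u" "T \<in> demanded E u p" "U \<in> demanded E u p" "x \<notin> U"
  obtains T' where "T' \<in> demanded E u p" "T - {x} \<subseteq> T'" "x \<notin> T'"
proof -
  let ?q = "p(x := p x + 1)"
  obtain T' where T': "T' \<in> demanded E u ?q" "{i\<in>T. p i = ?q i} \<subseteq> T'"
    by (rule gsD[OF assms(2) _ assms(3), of ?q]) auto
  have fin: "finite T'" using T'(1) assms(1) by (meson demandedD(1) finite_subset)
  have "sum ?q U = sum p U" using assms(5) by (intro sum.cong) auto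
  moreover have "sum ?q T' = sum p T' + (if x \<in> T' then 1 else 0)"
  proof (cases "x \<in> T'")
    case True
    have "sum ?q (T' - {x}) = sum p (T' - {x})" by (intro sum.cong) auto
    with True fin show ?thesis by (simp add: sum.remove)
  next
    case False
    then show ?thesis by (auto intro: sum.cong)
  qed
  moreover have "u U - sum ?q U \<le> u T' - sum ?q T'"
    using demandedD[OF T'(1)] demandedD(1)[OF assms(4)] by blast
  moreover have le: "u S - sum p S \<le> u U - sum p U" if "S \<subseteq> E" for S
    using demandedD(2)[OF assms(4) that] .
  moreover have sub: "T' \<subseteq> E" using demandedD(1)[OF T'(1)] .
  \<comment> \<open>\<open>U\<close> avoids \<open>x\<close>, so it still reaches the old optimum at
    \<open>?q\<close>, whereas any set containing \<open>x\<close> falls short of that optimum by at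
    least 1.\<close>
  ultimately have *: "x \<notin> T'" "u T' - sum p T' = u U - sum p U"
    using le[OF sub] by (smt (verit))+
  have "T' \<in> demanded E u p" using sub le *(2) by (intro demandedI) auto
  moreover have "T - {x} \<subseteq> T'" using T'(2) by auto
  ultimately show thesis using *(1) that by blast
qed

section \<open>The exchange property\<close>

text \<open>The exchange axiom of M-natural-concave set functions. Subtracting a linear price
  function preserves it, since an exchange only redistributes the items of the two sets.\<close>

definition exchange :: "'a set \<Rightarrow> ('a set \<Rightarrow> real) \<Rightarrow> bool" where
  "exchange E u \<longleftrightarrow> (\<forall>S T i. S \<subseteq> E \<longrightarrow> T \<subseteq> E \<longrightarrow> i \<in> S - T \<longrightarrow>
     u S + u T \<le> u (S - {i}) + u (insert i T) \<or>
     (\<exists>j\<in>T - S. u S + u T \<le> u (insert j (S - {i})) + u (insert i (T - {j}))))"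

text \<open>Take \<open>T\<close> demanded at the higher prices and missing as few kept items as possible. Exchanging
  a missing item between \<open>S\<close> and \<open>T\<close> does not lower the sum of their utilities, so it yields
  another demanded set, which misses one item less.\<close>

lemma exchange_imp_gs:
  assumes fin: "finite E" and ex: "exchange E u"
  shows "gs E u"
proof (rule gsI)
  fix p q :: "'a \<Rightarrow> real" and S
  assume pq: "\<And>i. i \<in> E \<Longrightarrow> p i \<le> q i" and S: "S \<in> demanded E u p"
  define K where "K = {i\<in>S. p i = q i}"
  have SE: "S \<subseteq> E" using demandedD(1)[OF S] .
  have finS: "finite S" using SE fin finite_subset by blast
  obtain T where T: "T \<in> demanded E u q"
    and min: "\<And>T'. T' \<in> demanded E u q \<Longrightarrow> card (K - T) \<le> card (K - T')"
    using ex_has_least_nat[of "\<lambda>T. T \<in> demanded E u q" _ "\<lambda>T. card (K - T)"]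
      demanded_nonempty[OF fin] by metis
  have TE: "T \<subseteq> E" using demandedD(1)[OF T] .
  have finT: "finite T" using TE fin finite_subset by blast
  have closer: False if "i \<in> K - T" "T' \<in> demanded E u q" "K - T' \<subseteq> K - T - {i}" for i T'
  proof -
    have "finite (K - T)" using finS by (simp add: K_def)
    with that(1,3) have "card (K - T') < card (K - T)"
      by (intro psubset_card_mono) auto
    with min[OF that(2)] show False by simp
  qed
  have "K \<subseteq> T"
  proof (rule ccontr)
    assume "\<not> K \<subseteq> T"
    then obtain i where i: "i \<in> K - T" by blast
    then have iS: "i \<in> S - T" and pqi: "p i = q i" by (auto simp: K_def)
    from ex SE TE iS consider
      (move) "u S + u T \<le> u (S - {i}) + u (insert i T)" |
      (swap) j where "j \<in> T - S" "u S + u T \<le> u (insert j (S - {i})) + u (insert i (T - {j}))"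
      unfolding exchange_def by blast
    then show False
    proof cases
      case move
      have "sum p S = p i + sum p (S - {i})" using iS finS by (simp add: sum.remove)
      moreover have "sum q (insert i T) = q i + sum q T" using iS finT by simp
      moreover have "u (S - {i}) - sum p (S - {i}) \<le> u S - sum p S"
        using demandedD(2)[OF S, of "S - {i}"] SE by blast
      ultimately have "u T - sum q T \<le> u (insert i T) - sum q (insert i T)"
        using move pqi by linarith
      moreover have "insert i T \<subseteq> E" using TE SE iS by blast
      ultimately have "insert i T \<in> demanded E u q"
        using demandedD(2)[OF T] by (intro demandedI) (auto intro: order_trans)
      then show False using closer[OF i] by blast
    next
      case swap
      have jE: "j \<in> E" and j: "j \<in> T" "j \<notin> S" using swap(1) TE by auto
      have "sum p S = p i + sum p (S - {i})" using iS finS by (simp add: sum.remove)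
      moreover have "sum p (insert j (S - {i})) = p j + sum p (S - {i})"
        using j finS by simp
      moreover have "sum q T = q j + sum q (T - {j})" using j finT by (simp add: sum.remove)
      moreover have "sum q (insert i (T - {j})) = q i + sum q (T - {j})"
        using iS finT by simp
      moreover have "u (insert j (S - {i})) - sum p (insert j (S - {i})) \<le> u S - sum p S"
        using demandedD(2)[OF S, of "insert j (S - {i})"] SE jE by blast
      \<comment> \<open>The item \<open>i\<close> costs the same under \<open>p\<close> and
        \<open>q\<close>, while \<open>j\<close> is released by \<open>T\<close> at
        \<open>q j\<close> and bought by \<open>S\<close> at \<open>p j \<le> q j\<close>. As
        \<open>S\<close> cannot gain, \<open>T\<close> cannot lose.\<close>
      ultimately have "u T - sum q T \<le> u (insert i (T - {j})) - sum q (insert i (T - {j}))"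
        using swap(2) pqi pq[OF jE] by linarith
      moreover have "insert i (T - {j}) \<subseteq> E" using TE SE iS by blast
      ultimately have "insert i (T - {j}) \<in> demanded E u q"
        using demandedD(2)[OF T] by (intro demandedI) (auto intro: order_trans)
      moreover have "K - insert i (T - {j}) \<subseteq> K - T - {i}" using j by (auto simp: K_def)
      ultimately show False using closer[OF i] by blast
    qed
  qed
  then show "\<exists>T\<in>demanded E u q. {i\<in>S. p i = q i} \<subseteq> T" using T K_def by blast
qed

text \<open>Partition valuations and the final example are both of this form. If the colour of
  \<open>i\<close> is repeated in \<open>S\<close>, moving \<open>i\<close> costs nothing; if
  \<open>T\<close> has that colour, swapping with an item of the same colour changes no colour set.
  Otherwise the move changes both counts by one, which concavity allows when \<open>T\<close> has
  fewer colours than \<open>S\<close>.\<close>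

lemma exchange_color_count:
  fixes g :: "nat \<Rightarrow> real" and c :: "'a \<Rightarrow> 'b"
  assumes fin: "finite E"
    and mono: "\<And>k l. k \<le> l \<Longrightarrow> g k \<le> g l"
    and concave: "\<And>k l. k \<le> l \<Longrightarrow> g (Suc l) + g k \<le> g l + g (Suc k)"
  shows "exchange E (\<lambda>S. g (card (c ` S)))"
  unfolding exchange_def
proof (intro allI impI)
  fix S T i assume SE: "S \<subseteq> E" and TE: "T \<subseteq> E" and i: "i \<in> S - T"
  have finS: "finite S" and finT: "finite T" using SE TE fin finite_subset by blast+
  have up: "g (card (c ` A)) \<le> g (card (c ` B))" if "c ` A \<subseteq> c ` B" "finite B" for A B
    using that by (intro mono card_mono) auto
  let ?move = "g (card (c ` S)) + g (card (c ` T))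
      \<le> g (card (c ` (S - {i}))) + g (card (c ` insert i T))"
  let ?swap = "\<lambda>j. g (card (c ` S)) + g (card (c ` T))
      \<le> g (card (c ` insert j (S - {i}))) + g (card (c ` insert i (T - {j})))"
  consider (dup) "c i \<in> c ` (S - {i})"
    | (shared) "c i \<notin> c ` (S - {i})" "c i \<in> c ` T"
    | (new) "c i \<notin> c ` (S - {i})" "c i \<notin> c ` T" by blast
  then show "?move \<or> (\<exists>j\<in>T - S. ?swap j)"
  proof cases
    case dup
    have "c ` S \<subseteq> c ` (S - {i})"
    proof
      fix y assume "y \<in> c ` S"
      then obtain x where "x \<in> S" "y = c x" by blast
      then show "y \<in> c ` (S - {i})" using dup by (cases "x = i") auto
    qed
    then have ?move using finS finT by (intro add_mono up) auto
    then show ?thesis ..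
  next
    case shared
    then obtain j where j: "j \<in> T" "c j = c i" by auto
    then have "j \<notin> S" using shared(1) i by (metis DiffI image_eqI singletonD DiffE)
    moreover have "c ` S \<subseteq> c ` insert j (S - {i})" using j by force
    moreover have "c ` T \<subseteq> c ` insert i (T - {j})" using j by force
    ultimately show ?thesis using j finS finT
      by (intro disjI2 bexI[of _ j] add_mono up) auto
  next
    case new
    have "c ` S = insert (c i) (c ` (S - {i}))" using i by blast
    then have cS: "card (c ` S) = Suc (card (c ` (S - {i})))" using new finS by simp
    have cT: "card (c ` insert i T) = Suc (card (c ` T))" using new finT by simp
    show ?thesis
    proof (cases "card (c ` T) < card (c ` S)")
      case True
      then have ?move using concave[of "card (c ` T)" "card (c ` (S - {i}))"] cS cT by simp
      then show ?thesis ..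
    next
      \<comment> \<open>Now \<open>T\<close> has at least as many colours as \<open>S\<close> but
        lacks that of \<open>i\<close>, so it has a colour foreign to \<open>S\<close>. Swapping
        \<open>i\<close> for an item \<open>j\<close> of such a colour keeps the count of
        \<open>S\<close> and does not lower that of \<open>T\<close>.\<close>
      case False
      have "\<not> c ` T \<subseteq> c ` S"
      proof
        assume "c ` T \<subseteq> c ` S"
        then have "c ` T \<subset> c ` S" using new i by blast
        then have "card (c ` T) < card (c ` S)" using finS by (intro psubset_card_mono) auto
        then show False using False by blast
      qed
      then obtain j where j: "j \<in> T" "c j \<notin> c ` S" by blast
      have "c ` insert j (S - {i}) = insert (c j) (c ` (S - {i}))" by blast
      moreover have "c j \<notin> c ` (S - {i})" using j by blast
      ultimately have "card (c ` insert j (S - {i})) = card (c ` S)" using cS finS by simp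
      moreover have "card (c ` T) \<le> card (c ` insert i (T - {j}))"
      proof -
        have "c ` T \<subseteq> insert (c j) (c ` (T - {j}))" by blast
        then have "card (c ` T) \<le> card (insert (c j) (c ` (T - {j})))"
          using finT by (intro card_mono) auto
        also have "\<dots> \<le> Suc (card (c ` (T - {j})))" using finT by (simp add: card_insert_if)
        also have "\<dots> = card (insert (c i) (c ` (T - {j})))"
          using new(2) finT by (subst card_insert_disjoint) auto
        finally show ?thesis by simp
      qed
      ultimately have "?swap j" using mono by simp
      then show ?thesis using j by blast
    qed
  qed
qed

section \<open>Weighted ranks of matroids\<close>

lemma matroidD:
  assumes "matroid E \<I>"
  shows "finite E" "{} \<in> \<I>" "\<And>A. A \<in> \<I> \<Longrightarrow> finite A"
    "\<And>A B. A \<in> \<I> \<Longrightarrow> B \<subseteq> A \<Longrightarrow> B \<in> \<I>"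
    "\<And>A B. A \<in> \<I> \<Longrightarrow> B \<in> \<I> \<Longrightarrow> card A < card B \<Longrightarrow> \<exists>x\<in>B - A. insert x A \<in> \<I>"
proof -
  show fin: "finite E" and "{} \<in> \<I>"
    "\<And>A B. A \<in> \<I> \<Longrightarrow> B \<subseteq> A \<Longrightarrow> B \<in> \<I>"
    "\<And>A B. A \<in> \<I> \<Longrightarrow> B \<in> \<I> \<Longrightarrow> card A < card B \<Longrightarrow> \<exists>x\<in>B - A. insert x A \<in> \<I>"
    using assms by (simp_all add: matroid_def)
  have "\<I> \<subseteq> Pow E" using assms by (simp add: matroid_def)
  then show "finite A" if "A \<in> \<I>" for A using fin that by (auto intro: finite_subset)
qed

text \<open>If every \<open>j\<close> fails, no element of the fundamental circuit of
  \<open>i\<close> can replace \<open>i\<close> in \<open>I\<close>, so \<open>I - {i}\<close> is a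
  largest independent set in its union with \<open>K\<close>. Extending \<open>K\<close> by elements
  of \<open>I\<close> to size \<open>card I\<close> must then use \<open>i\<close>, and so contains
  the whole circuit.\<close>

lemma matroid_symmetric_exchange:
  assumes M: "matroid E \<I>" and I: "I \<in> \<I>" and J: "J \<in> \<I>" and i: "i \<in> I - J"
    and dep: "insert i J \<notin> \<I>"
  shows "\<exists>j\<in>J - I. insert j (I - {i}) \<in> \<I> \<and> insert i (J - {j}) \<in> \<I>"
proof (rule ccontr)
  assume neg: "\<not> ?thesis"
  note fin = matroidD(3)[OF M] and sub = matroidD(4)[OF M] and aug = matroidD(5)[OF M]
  have extend: "\<exists>A'\<in>\<I>. A \<subseteq> A' \<and> A' \<subseteq> A \<union> B \<and> card A' = card B"
    if "A \<in> \<I>" "B \<in> \<I>" "card A \<le> card B" for A B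
    using that
  proof (induction "card B - card A" arbitrary: A)
    case 0
    then show ?case by auto
  next
    case (Suc k)
    then have "card A < card B" by simp
    then obtain x where x: "x \<in> B - A" "insert x A \<in> \<I>"
      using aug Suc.prems(1,2) by blast
    have "card (insert x A) = Suc (card A)" using x fin[OF Suc.prems(1)] by simp
    then obtain A' where "A' \<in> \<I>" "insert x A \<subseteq> A'" "A' \<subseteq> insert x A \<union> B" "card A' = card B"
      using Suc.hyps(1)[of "insert x A"] Suc.hyps(2) Suc.prems(2) x(2) by force
    then show ?case using x by (intro bexI[of _ A']) auto
  qed
  \<comment> \<open>\<open>K\<close> is the fundamental circuit of \<open>i\<close> with respect to \<open>J\<close>, without \<open>i\<close>.\<close>
  define K where "K = {j\<in>J. insert i (J - {j}) \<in> \<I>}"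
  have KI: "K \<in> \<I>" using sub[OF J] by (auto simp: K_def)
  \<comment> \<open>Otherwise the set would extend inside \<open>insert i J\<close> to size
    \<open>card J\<close>. As \<open>insert i J\<close> is dependent, the extension omits some
    \<open>j\<close> in \<open>J\<close>, hence equals \<open>insert i (J - {j})\<close>; but then
    \<open>j\<close> belongs to \<open>K\<close>, which the extension contains.\<close>
  have Ki: "insert i K \<notin> \<I>"
  proof
    assume indep: "insert i K \<in> \<I>"
    have "K \<noteq> J" using dep indep by blast
    then have "K \<subset> J" by (auto simp: K_def)
    then have "card K < card J" using fin[OF J] psubset_card_mono by blast
    moreover have "i \<notin> K" using i by (auto simp: K_def)
    ultimately have "card (insert i K) \<le> card J" using fin[OF KI] by simp
    then obtain A where A: "A \<in> \<I>" "insert i K \<subseteq> A" "A \<subseteq> insert i K \<union> J" "card A = card J"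
      using extend[OF indep J] by blast
    have "\<not> J \<subseteq> A"
    proof
      assume "J \<subseteq> A"
      then have "insert i J \<subseteq> A" using A by blast
      then show False using dep sub[OF A(1)] by blast
    qed
    then obtain j where j: "j \<in> J" "j \<notin> A" by blast
    have "A \<subseteq> insert i (J - {j})" using A(3) j by (auto simp: K_def)
    moreover have "card (insert i (J - {j})) = card A"
      using j i A(4) fin[OF J] by (simp add: card_gt_0_iff) (metis Suc_pred card_gt_0_iff empty_iff)
    ultimately have "A = insert i (J - {j})" using fin[OF J] by (intro card_subset_eq) auto
    then have "j \<in> K" using A(1) j by (auto simp: K_def)
    then show False using A(2) j by blast
  qed
  have Ii: "I - {i} \<in> \<I>" using sub[OF I] by blast
  have cI: "card I = Suc (card (I - {i}))" using i fin[OF I] by (intro card.remove) auto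
  \<comment> \<open>A larger \<open>A\<close> would augment \<open>I - {i}\<close> by an element of
    \<open>K\<close> outside \<open>I\<close>, which is exactly the exchange excluded by
    \<open>neg\<close>.\<close>
  have bound: "card A < card I" if A: "A \<in> \<I>" "A \<subseteq> (I - {i}) \<union> K" for A
  proof (rule ccontr)
    assume "\<not> card A < card I"
    then obtain x where x: "x \<in> A - (I - {i})" "insert x (I - {i}) \<in> \<I>"
      using aug[OF Ii A(1)] cI by auto
    then have "x \<in> J - I" "insert i (J - {x}) \<in> \<I>" using A(2) i by (auto simp: K_def)
    then show False using x neg by blast
  qed
  have "card K \<le> card I" using bound[OF KI] by auto
  then obtain A where A: "A \<in> \<I>" "K \<subseteq> A" "A \<subseteq> K \<union> I" "card A = card I"
    using extend[OF KI I] by blast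
  have "i \<in> A"
  proof (rule ccontr)
    assume "i \<notin> A"
    then have "A \<subseteq> (I - {i}) \<union> K" using A(3) by blast
    then show False using bound[OF A(1)] A(4) by simp
  qed
  then show False using Ki sub[OF A(1)] A(2) by blast
qed

definition max_weight :: "'a set set \<Rightarrow> ('a \<Rightarrow> real) \<Rightarrow> 'a set \<Rightarrow> real" where
  "max_weight \<I> w T = Max {\<Sum>i\<in>I. w i | I. I \<in> \<I> \<and> I \<subseteq> T}"

lemma max_weight_ge:
  assumes "finite T" "I \<in> \<I>" "I \<subseteq> T"
  shows "sum w I \<le> max_weight \<I> w T"
proof -
  have "finite ((\<lambda>I. sum w I) ` Pow T)" using assms(1) by simp
  then have "finite {\<Sum>i\<in>I. w i | I. I \<in> \<I> \<and> I \<subseteq> T}" by (rule rev_finite_subset) auto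
  then show ?thesis unfolding max_weight_def using assms(2,3) by (intro Max_ge) auto
qed

lemma max_weight_attained:
  assumes "finite T" "{} \<in> \<I>"
  obtains I where "I \<in> \<I>" "I \<subseteq> T" "max_weight \<I> w T = sum w I"
proof -
  have "finite ((\<lambda>I. sum w I) ` Pow T)" using assms(1) by simp
  then have "finite {\<Sum>i\<in>I. w i | I. I \<in> \<I> \<and> I \<subseteq> T}" by (rule rev_finite_subset) auto
  from Max_in[OF this] have "max_weight \<I> w T \<in> {\<Sum>i\<in>I. w i | I. I \<in> \<I> \<and> I \<subseteq> T}"
    unfolding max_weight_def using assms(2) by blast
  then show thesis using that by blast
qed

text \<open>The exchange is carried out on optimal independent sets \<open>I\<close> of
  \<open>S\<close> and \<open>J\<close> of \<open>T\<close>. It preserves their total weight, and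
  the new sets are candidates for the exchanged arguments.\<close>

lemma exchange_max_weight:
  assumes M: "matroid E \<I>"
  shows "exchange E (max_weight \<I> w)"
  unfolding exchange_def
proof (intro allI impI)
  fix S T i assume SE: "S \<subseteq> E" and TE: "T \<subseteq> E" and i: "i \<in> S - T"
  have finS: "finite S" and finT: "finite T"
    using SE TE matroidD(1)[OF M] finite_subset by blast+
  note emp = matroidD(2)[OF M] and sub = matroidD(4)[OF M]
  let ?f = "max_weight \<I> w"
  obtain I where I: "I \<in> \<I>" "I \<subseteq> S" "?f S = sum w I" using max_weight_attained[OF finS emp] .
  obtain J where J: "J \<in> \<I>" "J \<subseteq> T" "?f T = sum w J" using max_weight_attained[OF finT emp] .
  have finI: "finite I" and finJ: "finite J" using I J finS finT finite_subset by blast+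
  have ge: "?f S + ?f T \<le> ?f S' + ?f T'"
    if "I' \<in> \<I>" "J' \<in> \<I>" "I' \<subseteq> S'" "J' \<subseteq> T'" "finite S'" "finite T'"
      "sum w I' + sum w J' = sum w I + sum w J" for S' T' I' J'
    using max_weight_ge[of S' I' \<I> w] max_weight_ge[of T' J' \<I> w] that I J by simp
  consider (out) "i \<notin> I" | (move) "i \<in> I" "insert i J \<in> \<I>" | (swap) "i \<in> I" "insert i J \<notin> \<I>"
    by blast
  then show "?f S + ?f T \<le> ?f (S - {i}) + ?f (insert i T) \<or>
     (\<exists>j\<in>T - S. ?f S + ?f T \<le> ?f (insert j (S - {i})) + ?f (insert i (T - {j})))"
  proof cases
    case out
    then show ?thesis using I J finS finT by (intro disjI1 ge[of I J]) auto
  next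
    case move
    have "sum w (I - {i}) + sum w (insert i J) = sum w I + sum w J"
      using move i J finI finJ by (subst sum.insert) (auto simp: sum.remove)
    then show ?thesis using I J move finS finT sub[OF I(1)]
      by (intro disjI1 ge[of "I - {i}" "insert i J"]) auto
  next
    case swap
    then obtain j where j: "j \<in> J - I" "insert j (I - {i}) \<in> \<I>" "insert i (J - {j}) \<in> \<I>"
      using matroid_symmetric_exchange[OF M I(1) J(1)] i J by blast
    have "sum w (insert j (I - {i})) = w j + sum w (I - {i})" using j finI by simp
    moreover have "sum w (insert i (J - {j})) = w i + sum w (J - {j})"
      using i J finJ by (intro sum.insert) auto
    moreover have "sum w I = w i + sum w (I - {i})" using swap finI by (simp add: sum.remove)
    moreover have "sum w J = w j + sum w (J - {j})" using j finJ by (simp add: sum.remove)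
    ultimately have eq: "sum w (insert j (I - {i})) + sum w (insert i (J - {j})) = sum w I + sum w J"
      by simp
    show ?thesis
    proof (cases "j \<in> S")
      \<comment> \<open>An item \<open>j\<close> that already lies in \<open>S\<close> need not
        leave \<open>T\<close>: the new independent sets fit into \<open>S - {i}\<close> and
        \<open>insert i T\<close>, so the first alternative holds.\<close>
      case True
      moreover have "j \<noteq> i" using j swap by blast
      ultimately show ?thesis using I J j finS finT
        by (intro disjI1 ge[OF j(2,3) _ _ _ _ eq]) auto
    next
      case False
      then show ?thesis using I J j finS finT
        by (intro disjI2 bexI[of _ j] ge[OF j(2,3) _ _ _ _ eq]) auto
    qed
  qed
qed


section \<open>Operations that preserve gross substitutes\<close>

text \<open>This brings the two factors of a merge to a common ground set. Demand splits into demand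
  on \<open>E\<close> and a separate choice of worthless items, governed by the sign of their prices
  alone.\<close>

lemma gs_dummy_items:
  assumes fin: "finite E'" and sub: "E \<subseteq> E'" and gs: "gs E u"
  shows "gs E' (\<lambda>S. u (S \<inter> E))"
proof (rule gsI)
  fix p q :: "'a \<Rightarrow> real" and S
  assume pq: "\<And>i. i \<in> E' \<Longrightarrow> p i \<le> q i" and S: "S \<in> demanded E' (\<lambda>S. u (S \<inter> E)) p"
  have split: "sum r A = sum r (A \<inter> E) + sum r (A - E)" if "A \<subseteq> E'" for A and r :: "'a \<Rightarrow> real"
    using that fin by (metis add.commute finite_subset sum.Int_Diff)
  have SE: "S \<subseteq> E'" using demandedD(1)[OF S] .
  have "S \<inter> E \<in> demanded E u p"
  proof (rule demandedI)
    fix T assume T: "T \<subseteq> E"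
    define T' where "T' = T \<union> (S - E)"
    have T': "T' \<subseteq> E'" "T' \<inter> E = T" "T' - E = S - E" using T SE sub by (auto simp: T'_def)
    show "u T - sum p T \<le> u (S \<inter> E) - sum p (S \<inter> E)"
      using demandedD(2)[OF S T'(1)] split[OF T'(1), of p] split[OF SE, of p] T' by simp
  qed simp
  then obtain T where T: "T \<in> demanded E u q" "{i \<in> S \<inter> E. p i = q i} \<subseteq> T"
    by (rule gsD[OF gs, of p q, rotated]) (use pq sub in auto)
  have TE: "T \<subseteq> E" using demandedD(1)[OF T(1)] .
  \<comment> \<open>Price 0 is included: a worthless item demanded at \<open>p\<close> satisfies
    only \<open>p i \<le> 0\<close>, and it has to be kept if its price does not change.\<close>
  define D where "D = {i\<in>E' - E. q i \<le> 0}"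
  have TD: "(T \<union> D) \<inter> E = T" "(T \<union> D) - E = D" "T \<union> D \<subseteq> E'" using TE sub by (auto simp: D_def)
  have "T \<union> D \<in> demanded E' (\<lambda>S. u (S \<inter> E)) q"
  proof (rule demandedI)
    fix A assume A: "A \<subseteq> E'"
    have "sum q D \<le> sum q (A - E)"
    proof -
      have finA: "finite (A - E)" using A fin finite_subset by blast
      have finD: "finite D" using fin by (simp add: D_def)
      have "sum q D = sum q (D \<inter> (A - E)) + sum q (D - (A - E))"
        using finD by (rule sum.Int_Diff)
      also have "sum q (D - (A - E)) \<le> 0" by (rule sum_nonpos) (auto simp: D_def)
      also have "sum q (D \<inter> (A - E)) \<le> sum q (A - E)"
        using finA A by (intro sum_mono2) (auto simp: D_def)
      finally show ?thesis by simp
    qed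
    then show "u (A \<inter> E) - sum q A \<le> u ((T \<union> D) \<inter> E) - sum q (T \<union> D)"
      using demandedD(2)[OF T(1), of "A \<inter> E"] split[OF A, of q] split[OF TD(3), of q] TD by simp
  qed (rule TD)
  moreover have "{i\<in>S. p i = q i} \<subseteq> T \<union> D"
  proof
    fix i assume i: "i \<in> {i\<in>S. p i = q i}"
    show "i \<in> T \<union> D"
    proof (cases "i \<in> E")
      case True
      then show ?thesis using i T(2) by blast
    next
      case False
      have "(S - {i}) \<inter> E = S \<inter> E" using False by blast
      moreover have "sum p S = p i + sum p (S - {i})"
        using i SE fin by (intro sum.remove) (auto intro: finite_subset)
      ultimately have "p i \<le> 0" using demandedD(2)[OF S, of "S - {i}"] SE by auto
      then show ?thesis using i False SE by (auto simp: D_def)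
    qed
  qed
  ultimately show "\<exists>T\<in>demanded E' (\<lambda>S. u (S \<inter> E)) q. {i\<in>S. p i = q i} \<subseteq> T" by blast
qed

text \<open>Values and prices are additive over the two summands, so a set is demanded exactly when
  each of its halves is demanded.\<close>

lemma gs_direct_sum:
  assumes fin: "finite A" "finite B" and gs: "gs A u" "gs B v"
  shows "gs (A <+> B) (\<lambda>S. u (Inl -` S) + v (Inr -` S))"
proof (rule gsI)
  fix p q :: "'a + 'b \<Rightarrow> real" and S
  let ?f = "\<lambda>S. u (Inl -` S) + v (Inr -` S)"
  assume pq: "\<And>i. i \<in> A <+> B \<Longrightarrow> p i \<le> q i" and S: "S \<in> demanded (A <+> B) ?f p"
  have split: "sum r T = sum (\<lambda>i. r (Inl i)) (Inl -` T) + sum (\<lambda>i. r (Inr i)) (Inr -` T)"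
    and sub: "Inl -` T \<subseteq> A" "Inr -` T \<subseteq> B"
    if "T \<subseteq> A <+> B" for T and r :: "'a + 'b \<Rightarrow> real"
  proof -
    show sub: "Inl -` T \<subseteq> A" "Inr -` T \<subseteq> B" using that by auto
    have finT: "finite (Inl -` T)" "finite (Inr -` T)" using sub fin finite_subset by blast+
    have "T = Inl -` T <+> Inr -` T"
    proof
      show "T \<subseteq> Inl -` T <+> Inr -` T"
      proof
        fix i assume "i \<in> T"
        then show "i \<in> Inl -` T <+> Inr -` T" by (cases i) auto
      qed
    qed auto
    then have "sum r T = sum r (Inl -` T <+> Inr -` T)" by simp
    also have "\<dots> = sum (\<lambda>i. r (Inl i)) (Inl -` T) + sum (\<lambda>i. r (Inr i)) (Inr -` T)"
      using finT by (simp add: sum.Plus comp_def)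
    finally show "sum r T = sum (\<lambda>i. r (Inl i)) (Inl -` T) + sum (\<lambda>i. r (Inr i)) (Inr -` T)" .
  qed
  have demanded_iff: "T \<in> demanded (A <+> B) ?f r \<longleftrightarrow> T \<subseteq> A <+> B \<and>
      Inl -` T \<in> demanded A u (\<lambda>i. r (Inl i)) \<and> Inr -` T \<in> demanded B v (\<lambda>i. r (Inr i))"
    (is "?L \<longleftrightarrow> ?R") for T and r :: "'a + 'b \<Rightarrow> real"
  proof
    assume L: ?L
    note T = demandedD(1)[OF L]
    have "Inl -` T \<in> demanded A u (\<lambda>i. r (Inl i))"
    proof (rule demandedI)
      fix X assume X: "X \<subseteq> A"
      define T' where "T' = X <+> Inr -` T"
      have T': "T' \<subseteq> A <+> B" "Inl -` T' = X" "Inr -` T' = Inr -` T"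
        using X sub[OF T] by (auto simp: T'_def)
      show "u X - sum (\<lambda>i. r (Inl i)) X \<le> u (Inl -` T) - sum (\<lambda>i. r (Inl i)) (Inl -` T)"
        using demandedD(2)[OF L T'(1)] split[OF T'(1), of r] split[OF T, of r] T' by simp
    qed (rule sub[OF T])
    moreover have "Inr -` T \<in> demanded B v (\<lambda>i. r (Inr i))"
    proof (rule demandedI)
      fix X assume X: "X \<subseteq> B"
      define T' where "T' = Inl -` T <+> X"
      have T': "T' \<subseteq> A <+> B" "Inl -` T' = Inl -` T" "Inr -` T' = X"
        using X sub[OF T] by (auto simp: T'_def)
      show "v X - sum (\<lambda>i. r (Inr i)) X \<le> v (Inr -` T) - sum (\<lambda>i. r (Inr i)) (Inr -` T)"
        using demandedD(2)[OF L T'(1)] split[OF T'(1), of r] split[OF T, of r] T' by simp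
    qed (rule sub[OF T])
    ultimately show ?R using T by blast
  next
    assume R: ?R
    show ?L
    proof (rule demandedI)
      fix T' assume T': "T' \<subseteq> A <+> B"
      have "u (Inl -` T') - sum (\<lambda>i. r (Inl i)) (Inl -` T')
            \<le> u (Inl -` T) - sum (\<lambda>i. r (Inl i)) (Inl -` T)"
        using R sub[OF T'] demandedD(2) by blast
      moreover have "v (Inr -` T') - sum (\<lambda>i. r (Inr i)) (Inr -` T')
            \<le> v (Inr -` T) - sum (\<lambda>i. r (Inr i)) (Inr -` T)"
        using R sub[OF T'] demandedD(2) by blast
      ultimately show "?f T' - sum r T' \<le> ?f T - sum r T"
        using split[OF T', of r] split[of T r] R by simp
    qed (use R in blast)
  qed
  obtain X where X: "X \<in> demanded A u (\<lambda>i. q (Inl i))"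
    "{i \<in> Inl -` S. p (Inl i) = q (Inl i)} \<subseteq> X"
    by (rule gsD[OF gs(1), of "\<lambda>i. p (Inl i)" "\<lambda>i. q (Inl i)" "Inl -` S"])
      (use S pq in \<open>auto simp: demanded_iff\<close>)
  obtain Y where Y: "Y \<in> demanded B v (\<lambda>i. q (Inr i))"
    "{i \<in> Inr -` S. p (Inr i) = q (Inr i)} \<subseteq> Y"
    by (rule gsD[OF gs(2), of "\<lambda>i. p (Inr i)" "\<lambda>i. q (Inr i)" "Inr -` S"])
      (use S pq in \<open>auto simp: demanded_iff\<close>)
  have XY: "Inl -` (X <+> Y) = X" "Inr -` (X <+> Y) = Y" by auto
  have "X <+> Y \<in> demanded (A <+> B) ?f q"
    using X(1) Y(1) demandedD(1)[OF X(1)] demandedD(1)[OF Y(1)]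
    unfolding demanded_iff XY by blast
  moreover have "{i\<in>S. p i = q i} \<subseteq> X <+> Y"
  proof
    fix i assume "i \<in> {i\<in>S. p i = q i}"
    then show "i \<in> X <+> Y" using X(2) Y(2) by (cases i) auto
  qed
  ultimately show "\<exists>T\<in>demanded (A <+> B) ?f q. {i\<in>S. p i = q i} \<subseteq> T" by blast
qed

lemma gs_rename:
  assumes inj: "inj f" and gs: "gs (f ` E) u"
  shows "gs E (\<lambda>S. u (f ` S))"
proof (rule gsI)
  fix p q :: "'a \<Rightarrow> real" and S
  assume pq: "\<And>i. i \<in> E \<Longrightarrow> p i \<le> q i" and S: "S \<in> demanded E (\<lambda>S. u (f ` S)) p"
  have sum_f: "sum (\<lambda>i. r (inv f i)) (f ` T) = sum r T" for r :: "'a \<Rightarrow> real" and T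
    using inj by (simp add: sum.reindex inj_on_subset)
  have demanded_f: "f ` T \<in> demanded (f ` E) u (\<lambda>i. r (inv f i)) \<longleftrightarrow>
      T \<in> demanded E (\<lambda>S. u (f ` S)) r" for r :: "'a \<Rightarrow> real" and T
    using inj by (simp add: demanded_def all_subset_image sum_f inj_image_subset_iff)
  obtain T where T: "T \<in> demanded (f ` E) u (\<lambda>i. q (inv f i))"
    "{i \<in> f ` S. p (inv f i) = q (inv f i)} \<subseteq> T"
    by (rule gsD[OF gs, of "\<lambda>i. p (inv f i)" "\<lambda>i. q (inv f i)" "f ` S"])
      (use S pq inj in \<open>auto simp: demanded_f\<close>)
  obtain T' where T': "T = f ` T'" using demandedD(1)[OF T(1)] by (auto simp: subset_image_iff)
  have "T' \<in> demanded E (\<lambda>S. u (f ` S)) q" using T(1) by (simp add: T' demanded_f)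
  moreover have "{i\<in>S. p i = q i} \<subseteq> T'"
    using T(2) inj by (auto simp: T' inj_image_mem_iff subset_iff dest: injD)
  ultimately show "\<exists>T\<in>demanded E (\<lambda>S. u (f ` S)) q. {i\<in>S. p i = q i} \<subseteq> T" by blast
qed

section \<open>Identifying two copies of one item\<close>

definition identify :: "'a \<Rightarrow> 'a \<Rightarrow> ('a set \<Rightarrow> real) \<Rightarrow> 'a set \<Rightarrow> real" where
  "identify x y w S = (if x \<in> S then max (w S) (w (insert y (S - {x}))) else w S)"

text \<open>Demand for \<open>identify x y w\<close> at price \<open>t\<^sub>0\<close> of the item \<open>x\<close> is demand for \<open>w\<close>, restricted to
  sets that do not contain both \<open>x\<close> and \<open>y\<close>, when both are priced at a common \<open>t \<ge> t\<^sub>0\<close>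
  such that exactly one of them is demanded or \<open>t = t\<^sub>0\<close>.\<close>

locale identification =
  fixes E :: "'a set" and w :: "'a set \<Rightarrow> real" and x y :: 'a
  assumes fin: "finite E" and gs_w: "gs E w" and xE: "x \<in> E" and yE: "y \<in> E" and xy: "x \<noteq> y"
begin

definition price :: "('a \<Rightarrow> real) \<Rightarrow> real \<Rightarrow> 'a \<Rightarrow> real" where
  "price p t = p(x := t, y := t)"

definition image_of :: "'a set \<Rightarrow> 'a set" where
  "image_of T = (if y \<in> T then insert x (T - {y}) else T)"

definition equilibrium :: "('a \<Rightarrow> real) \<Rightarrow> real \<Rightarrow> 'a set \<Rightarrow> bool" where
  "equilibrium p t T \<longleftrightarrow> T \<in> demanded E w (price p t) \<and> \<not> (x \<in> T \<and> y \<in> T) \<and> p x \<le> t \<and>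
     (t = p x \<or> x \<in> T \<or> y \<in> T)"

lemma sum_price:
  assumes "T \<subseteq> E"
  shows "sum (price p t) T =
    sum p (T - {x, y}) + (if x \<in> T then t else 0) + (if y \<in> T then t else 0)"
proof -
  have finT: "finite T" using assms fin finite_subset by blast
  have "sum (price p t) T = sum (price p t) (T - {x, y}) + sum (price p t) (T \<inter> {x, y})"
    using finT by (metis add.commute sum.Int_Diff)
  moreover have "sum (price p t) (T - {x, y}) = sum p (T - {x, y})"
    by (intro sum.cong) (auto simp: price_def)
  moreover have "sum (price p t) (T \<inter> {x, y}) = (if x \<in> T then t else 0) + (if y \<in> T then t else 0)"
    using xy by (auto simp: price_def Int_insert_right)
  ultimately show ?thesis by simp
qed

text \<open>Passing from \<open>w\<close> at the common price to \<open>identify x y w\<close> at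
  \<open>p\<close> thus refunds \<open>t - p x\<close> to the sets that use the item, and nothing to
  the others.\<close>

lemma sum_price_image:
  assumes "T \<subseteq> E" "\<not> (x \<in> T \<and> y \<in> T)"
  shows "sum (price p t) T = sum p (image_of T) + (if x \<in> image_of T then t - p x else 0)"
proof -
  have finT: "finite T" using assms fin finite_subset by blast
  have eq: "image_of T - {x} = T - {x, y}" by (auto simp: image_of_def)
  have mem: "x \<in> image_of T \<longleftrightarrow> x \<in> T \<or> y \<in> T" by (auto simp: image_of_def)
  have "finite (image_of T)" using finT by (simp add: image_of_def)
  then have "sum p (image_of T) = sum p (T - {x, y}) + (if x \<in> image_of T then p x else 0)"
    using eq by (cases "x \<in> image_of T") (auto simp: sum.remove)
  then show ?thesis using sum_price[OF assms(1)] mem assms(2) by auto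
qed

lemma identify_ge:
  assumes "\<not> (x \<in> T \<and> y \<in> T)"
  shows "w T \<le> identify x y w (image_of T)"
proof (cases "y \<in> T")
  case True
  then have "insert y (insert x (T - {y}) - {x}) = T" using assms xy by auto
  then show ?thesis using True by (simp add: identify_def image_of_def)
qed (simp add: identify_def image_of_def)

lemma identify_attained:
  assumes "S \<subseteq> E - {y}"
  obtains T where "T \<subseteq> E" "\<not> (x \<in> T \<and> y \<in> T)" "image_of T = S" "identify x y w S = w T"
proof (cases "x \<in> S \<and> w S < w (insert y (S - {x}))")
  case True
  have "image_of (insert y (S - {x})) = S" using True assms by (auto simp: image_of_def)
  then show thesis using True assms yE xy
    by (intro that[of "insert y (S - {x})"]) (auto simp: identify_def)
next
  case False
  then show thesis using assms
    by (intro that[of S]) (auto simp: identify_def image_of_def)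
qed

text \<open>The refund is nonnegative, and an equilibrium set receives the largest one: either it
  uses a copy, or \<open>t = p x\<close> and all refunds vanish. Hence it stays optimal.\<close>

lemma equilibrium_imp_demanded:
  assumes "equilibrium p t T"
  shows "image_of T \<in> demanded (E - {y}) (identify x y w) p"
proof (rule demandedI)
  have T: "T \<in> demanded E w (price p t)" "\<not> (x \<in> T \<and> y \<in> T)" "p x \<le> t"
    and tx: "t = p x \<or> x \<in> image_of T"
    using assms by (auto simp: equilibrium_def image_of_def)
  note TE = demandedD(1)[OF T(1)]
  show "image_of T \<subseteq> E - {y}" using TE xE xy by (auto simp: image_of_def)
  fix S assume "S \<subseteq> E - {y}"
  then obtain T' where T': "T' \<subseteq> E" "\<not> (x \<in> T' \<and> y \<in> T')" "image_of T' = S"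
    "identify x y w S = w T'" by (rule identify_attained)
  have "w T' - sum (price p t) T' \<le> w T - sum (price p t) T" using demandedD(2)[OF T(1) T'(1)] .
  then show "identify x y w S - sum p S \<le> identify x y w (image_of T) - sum p (image_of T)"
    using sum_price_image[OF T'(1,2), of p t] sum_price_image[OF TE T(2), of p t] T' T(3) tx
      identify_ge[OF T(2)] by (auto split: if_splits)
qed

text \<open>One equilibrium price supports all demanded sets. If \<open>S\<close> avoids
  \<open>x\<close>, matching \<open>T0\<close> without the refund would make its preimage better
  than \<open>T0\<close> at the common price by \<open>t - p x\<close>, so this difference is
  0.\<close>

lemma demanded_imp_equilibrium:
  assumes eq: "equilibrium p t T0" and S: "S \<in> demanded (E - {y}) (identify x y w) p"
  obtains T where "equilibrium p t T" "image_of T = S"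
proof -
  have T0: "T0 \<in> demanded E w (price p t)" "\<not> (x \<in> T0 \<and> y \<in> T0)" "p x \<le> t"
    and tx: "t = p x \<or> x \<in> image_of T0"
    using eq by (auto simp: equilibrium_def image_of_def)
  obtain T where T: "T \<subseteq> E" "\<not> (x \<in> T \<and> y \<in> T)" "image_of T = S" "identify x y w S = w T"
    using demandedD(1)[OF S] by (rule identify_attained)
  have "identify x y w (image_of T0) - sum p (image_of T0) \<le> identify x y w S - sum p S"
    using demandedD(2)[OF S] demandedD(1)[OF equilibrium_imp_demanded[OF eq]] by blast
  then have ge: "w T0 - sum (price p t) T0 + (if x \<in> S then 0 else t - p x)
      \<le> w T - sum (price p t) T"
    using sum_price_image[OF T(1,2), of p t] T identify_ge[OF T0(2)] tx
      sum_price_image[OF demandedD(1)[OF T0(1)] T0(2), of p t] by (auto split: if_splits)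
  have max: "w A - sum (price p t) A \<le> w T0 - sum (price p t) T0" if "A \<subseteq> E" for A
    using demandedD(2)[OF T0(1) that] .
  have "T \<in> demanded E w (price p t)"
  proof (rule demandedI)
    fix A assume "A \<subseteq> E"
    from max[OF this] show "w A - sum (price p t) A \<le> w T - sum (price p t) T"
      using ge T0(3) by (auto split: if_splits)
  qed (rule T)
  moreover have "t = p x \<or> x \<in> S" using ge max[OF T(1)] T0(3) by (auto split: if_splits)
  then have "t = p x \<or> x \<in> T \<or> y \<in> T" using T(3) by (auto simp: image_of_def split: if_splits)
  ultimately have "equilibrium p t T" using T(2) T0(3) by (simp add: equilibrium_def)
  then show thesis using that T(3) by blast
qed

text \<open>Raise the common price until the sets containing both \<open>x\<close> and \<open>y\<close> first tie with some other
  set, then drop one of the two items.\<close>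

lemma raise_to_equilibrium:
  assumes T0: "T0 \<in> demanded E w (price q t0)" "x \<in> T0" "y \<in> T0" and t0: "q x \<le> t0"
  obtains t T where "equilibrium q t T" "T0 - {x, y} \<subseteq> T" "x \<in> T \<or> y \<in> T"
proof -
  define R where "R T = w T - sum q (T - {x, y})" for T
  define k :: "'a set \<Rightarrow> real" where
    "k T = (if x \<in> T then 1 else 0) + (if y \<in> T then 1 else 0)" for T
  have util: "w T - sum (price q t) T = R T - k T * t" if "T \<subseteq> E" for T t
    using sum_price[OF that, of q t] by (auto simp: R_def k_def)
  define N where "N = {T. T \<subseteq> E \<and> \<not> (x \<in> T \<and> y \<in> T)}"
  \<comment> \<open>\<open>k\<close> counts the copies in a set, so \<open>d T\<close> is the common
    price at which \<open>T\<close> ties with \<open>T0\<close>, which holds both. The least such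
    price over \<open>N\<close> is where \<open>T0\<close> first meets a rival.\<close>
  define d where "d T = (R T0 - R T) / (2 - k T)" for T
  have finN: "finite N" using fin by (simp add: N_def)
  have "{} \<in> N" by (simp add: N_def)
  then have ne: "d ` N \<noteq> {}" by blast
  define t where "t = Min (d ` N)"
  have "t \<in> d ` N" unfolding t_def using finN ne by (intro Min_in) auto
  then obtain U where U: "U \<in> N" "d U = t" by auto
  have kN: "2 - k T > 0" if "T \<in> N" for T using that by (auto simp: k_def N_def)
  have k0: "k T0 = 2" using T0 by (simp add: k_def)
  have T0E: "T0 \<subseteq> E" using demandedD(1)[OF T0(1)] .
  have "t0 \<le> t"
  proof -
    have UE: "U \<subseteq> E" using U by (simp add: N_def)
    have "R U - k U * t0 \<le> R T0 - 2 * t0"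
      using demandedD(2)[OF T0(1) UE] util[OF UE] util[OF T0E] k0 by simp
    then have "t0 * (2 - k U) \<le> R T0 - R U" by (simp add: algebra_simps)
    then have "t0 \<le> d U" using kN[OF U(1)] by (simp add: d_def pos_le_divide_eq)
    then show ?thesis using U(2) by simp
  qed
  have le: "R T - k T * t \<le> R T0 - 2 * t" if T: "T \<subseteq> E" for T
  proof (cases "T \<in> N")
    case True
    then have "t \<le> d T" unfolding t_def using finN by simp
    then have "t * (2 - k T) \<le> R T0 - R T"
      using kN[OF True] by (simp add: d_def pos_le_divide_eq)
    then show ?thesis by (simp add: algebra_simps)
  next
    \<comment> \<open>Sets holding both copies are charged \<open>2 * t\<close> just like
      \<open>T0\<close>, so their comparison with \<open>T0\<close> does not depend on
      \<open>t\<close>.\<close>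
    case False
    then have "k T = 2" using T by (simp add: N_def k_def)
    then show ?thesis using demandedD(2)[OF T0(1) T] util[OF T] util[OF T0E] k0 by simp
  qed
  have UE: "U \<subseteq> E" using U by (simp add: N_def)
  have "t * (2 - k U) = R T0 - R U" using U kN[OF U(1)] by (auto simp: d_def field_simps)
  then have tie: "R U - k U * t = R T0 - 2 * t" by (simp add: algebra_simps)
  have T0t: "T0 \<in> demanded E w (price q t)"
    using le util T0E k0 by (intro demandedI) auto
  have Ut: "U \<in> demanded E w (price q t)"
    using le util UE tie by (intro demandedI) auto
  have tq: "q x \<le> t" using t0 \<open>t0 \<le> t\<close> by simp
  show thesis
  proof (cases "x \<in> U")
    case False
    then obtain T where "T \<in> demanded E w (price q t)" "T0 - {x} \<subseteq> T" "x \<notin> T"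
      using gs_drop_item[OF fin gs_w T0t Ut] by blast
    then show thesis using T0 xy tq by (intro that[of t T]) (auto simp: equilibrium_def)
  next
    case True
    then have "y \<notin> U" using U by (simp add: N_def)
    then obtain T where "T \<in> demanded E w (price q t)" "T0 - {y} \<subseteq> T" "y \<notin> T"
      using gs_drop_item[OF fin gs_w T0t Ut] by blast
    then show thesis using T0 xy tq by (intro that[of t T]) (auto simp: equilibrium_def)
  qed
qed

lemma equilibrium_exists: "\<exists>t T. equilibrium p t T"
proof -
  obtain T where T: "T \<in> demanded E w (price p (p x))" using demanded_nonempty[OF fin] by blast
  show ?thesis
  proof (cases "x \<in> T \<and> y \<in> T")
    case True
    then show ?thesis using raise_to_equilibrium[OF T] by blast
  next
    case False
    then show ?thesis using T by (auto simp: equilibrium_def)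
  qed
qed

text \<open>The demanded set is lifted to an equilibrium for \<open>p\<close>, gross substitutes of
  \<open>w\<close> is applied there, and the result is projected back. Only the copies carry the
  common price, so all other items with unchanged prices survive; a result holding both copies is
  repaired by \<open>raise_to_equilibrium\<close>, which gives up no other item.\<close>

lemma gs_identify: "gs (E - {y}) (identify x y w)"
proof (rule gsI)
  fix p q :: "'a \<Rightarrow> real" and S
  assume pq: "\<And>i. i \<in> E - {y} \<Longrightarrow> p i \<le> q i"
    and S: "S \<in> demanded (E - {y}) (identify x y w) p"
  have SE: "S \<subseteq> E - {y}" using demandedD(1)[OF S] .
  obtain t T0 where "equilibrium p t T0" using equilibrium_exists by blast
  then obtain S' where S': "equilibrium p t S'" "image_of S' = S"
    using demanded_imp_equilibrium[OF _ S] by blast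
  have S'E: "S' \<in> demanded E w (price p t)" and tp: "p x \<le> t"
    and S'x: "t = p x \<or> x \<in> S' \<or> y \<in> S'"
    using S'(1) by (auto simp: equilibrium_def)
  have Sx: "x \<in> S \<longleftrightarrow> x \<in> S' \<or> y \<in> S'" and Soff: "S - {x} = S' - {x, y}"
    using S'(2) SE by (auto simp: image_of_def split: if_splits)
  \<comment> \<open>At least \<open>t\<close>, so that prices only rise, and at least
    \<open>q x\<close>, as an equilibrium for \<open>q\<close> demands.\<close>
  define t0 where "t0 = max t (q x)"
  have pqx: "p x \<le> q x" using pq xE xy by blast
  obtain T where T: "T \<in> demanded E w (price q t0)"
    "{i\<in>S'. price p t i = price q t0 i} \<subseteq> T"
    by (rule gsD[OF gs_w _ S'E, of "price q t0"]) (use pq in \<open>auto simp: price_def t0_def\<close>)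
  have keep: "i \<in> T" if "i \<in> S" "p i = q i" "i \<noteq> x" for i
  proof -
    have "i \<noteq> y" using that SE by blast
    moreover have "i \<in> S'" using that Soff by blast
    ultimately have "i \<in> {i\<in>S'. price p t i = price q t0 i}" using that by (simp add: price_def)
    then show ?thesis using T(2) by blast
  qed
  have keepx: "x \<in> T \<or> y \<in> T" if "x \<in> S' \<or> y \<in> S'" "t0 = t"
    using that T(2) by (auto simp: price_def)
  have concl: "\<exists>T\<in>demanded (E - {y}) (identify x y w) q. {i\<in>S. p i = q i} \<subseteq> T"
    if "equilibrium q t' T'" "T - {x, y} \<subseteq> T'"
    "x \<in> S \<Longrightarrow> p x = q x \<Longrightarrow> x \<in> T' \<or> y \<in> T'" for t' T'
  proof (rule bexI[OF _ equilibrium_imp_demanded[OF that(1)]])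
    show "{i\<in>S. p i = q i} \<subseteq> image_of T'"
    proof
      fix i assume i: "i \<in> {i\<in>S. p i = q i}"
      show "i \<in> image_of T'"
      proof (cases "i = x")
        case True
        then show ?thesis using i that(3) by (auto simp: image_of_def)
      next
        case False
        moreover have "i \<noteq> y" using i SE by blast
        ultimately show ?thesis using keep[of i] i that(2) by (auto simp: image_of_def)
      qed
    qed
  qed
  show "\<exists>T\<in>demanded (E - {y}) (identify x y w) q. {i\<in>S. p i = q i} \<subseteq> T"
  proof (cases "x \<in> T \<and> y \<in> T")
    case True
    then obtain t' T' where "equilibrium q t' T'" "T - {x, y} \<subseteq> T'" "x \<in> T' \<or> y \<in> T'"
      using raise_to_equilibrium[OF T(1)] by (auto simp: t0_def)
    then show ?thesis using concl by blast
  next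
    case False
    \<comment> \<open>If \<open>t0\<close> exceeds \<open>q x\<close>, then
      \<open>t0 = t > p x\<close>, so \<open>S'\<close> uses a copy; the price of that copy is
      unchanged, and \<open>T\<close> keeps it.\<close>
    have "t0 = q x \<or> x \<in> T \<or> y \<in> T"
      using keepx S'x pqx tp by (auto simp: t0_def max_def split: if_splits)
    then have "equilibrium q t0 T" using False T(1) by (auto simp: equilibrium_def t0_def)
    moreover have "x \<in> T \<or> y \<in> T" if "x \<in> S" "p x = q x"
    proof -
      have "t0 = t" using that(2) tp by (simp add: t0_def)
      then show ?thesis using keepx that(1) Sx by blast
    qed
    ultimately show ?thesis using concl by blast
  qed
qed

end


text \<open>An intermediate stage between direct sum and merge: items of \<open>K\<close> are
  offered only as left copies, and \<open>M\<close> is the set of those handed over to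
  \<open>v\<close>.\<close>

definition partial_merge :: "('a set \<Rightarrow> real) \<Rightarrow> ('a set \<Rightarrow> real) \<Rightarrow> 'a set \<Rightarrow> ('a + 'a) set \<Rightarrow> real" where
  "partial_merge u v K S = Max ((\<lambda>M. u (Inl -` S - M) + v (Inr -` S \<union> M)) ` Pow (K \<inter> Inl -` S))"

text \<open>The choices of \<open>M\<close> split by whether \<open>x\<close> is handed over.
  Handing it over amounts to replacing \<open>Inl x\<close> by \<open>Inr x\<close> before merging
  along \<open>K\<close>.\<close>

lemma partial_merge_insert:
  assumes fin: "finite K" and x: "x \<notin> K"
  shows "partial_merge u v (insert x K) S = identify (Inl x) (Inr x) (partial_merge u v K) S"
proof (cases "Inl x \<in> S")
  case False
  then have "insert x K \<inter> Inl -` S = K \<inter> Inl -` S" by auto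
  then show ?thesis using False by (simp add: identify_def partial_merge_def)
next
  case True
  define L where "L = K \<inter> Inl -` S"
  define S' where "S' = insert (Inr x) (S - {Inl x})"
  let ?val = "\<lambda>S M. u (Inl -` S - M) + v (Inr -` S \<union> M)"
  have finL: "finite L" using fin by (simp add: L_def)
  have vimage: "Inl -` S' = Inl -` S - {x}" "Inr -` S' = insert x (Inr -` S)" by (auto simp: S'_def)
  have KL: "K \<inter> (Inl -` S - {x}) = L" using x by (auto simp: L_def)
  have "Inl -` S - {x} - M = Inl -` S - insert x M" for M by blast
  then have S': "partial_merge u v K S' = Max (?val S ` insert x ` Pow L)"
    unfolding partial_merge_def vimage KL image_image by simp
  have "insert x K \<inter> Inl -` S = insert x L" using True by (auto simp: L_def)
  then have "partial_merge u v (insert x K) S = Max (?val S ` Pow L \<union> ?val S ` insert x ` Pow L)"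
    by (simp add: partial_merge_def Pow_insert image_Un)
  also have "\<dots> = max (Max (?val S ` Pow L)) (Max (?val S ` insert x ` Pow L))"
    using finL by (intro Max_Un) auto
  also have "\<dots> = max (partial_merge u v K S) (partial_merge u v K S')"
    using S' by (simp add: partial_merge_def L_def)
  finally show ?thesis using True by (simp add: identify_def S'_def)
qed

lemma gs_partial_merge:
  assumes fin: "finite E" and gs: "gs E u" "gs E v" and K: "K \<subseteq> E"
  shows "gs (E <+> (E - K)) (partial_merge u v K)"
  using finite_subset[OF K fin] K
proof (induction K rule: finite_induct)
  case empty
  have "partial_merge u v {} = (\<lambda>S. u (Inl -` S) + v (Inr -` S))"
    by (simp add: partial_merge_def fun_eq_iff)
  then show ?case using gs_direct_sum[OF fin fin gs] by simp
next
  case (insert x K)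
  interpret identification "E <+> (E - K)" "partial_merge u v K" "Inl x" "Inr x"
    using insert fin by unfold_locales auto
  have "E <+> (E - insert x K) = (E <+> (E - K)) - {Inr x}" by auto
  moreover have "partial_merge u v (insert x K) = identify (Inl x) (Inr x) (partial_merge u v K)"
    using partial_merge_insert[OF insert.hyps] by (simp add: fun_eq_iff)
  ultimately show ?case using gs_identify by simp
qed

text \<open>For \<open>K = E\<close> all right copies have disappeared, and \<open>Inl\<close>
  renames the remaining items.\<close>

lemma gs_convolution:
  fixes u v :: "'a set \<Rightarrow> real"
  assumes fin: "finite E" and gs: "gs E u" "gs E v"
  shows "gs E (\<lambda>S. Max ((\<lambda>M. u (S - M) + v M) ` Pow S))"
proof -
  have "gs (Inl ` E) (partial_merge u v E)"
    using gs_partial_merge[OF fin gs subset_refl] by (simp add: Plus_def)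
  from gs_rename[OF _ this] have "gs E (\<lambda>S. partial_merge u v E (Inl ` S))" by simp
  moreover have "partial_merge u v E (Inl ` S) = Max ((\<lambda>M. u (S - M) + v M) ` Pow S)"
    if "S \<subseteq> E" for S
  proof -
    have "Inl -` (Inl ` S :: ('a + 'a) set) = S" "Inr -` (Inl ` S :: ('a + 'a) set) = {}" by auto
    moreover have "E \<inter> S = S" using that by blast
    ultimately show ?thesis by (simp only: partial_merge_def Un_empty_left)
  qed
  ultimately show ?thesis
    using gs_cong[of E "\<lambda>S. partial_merge u v E (Inl ` S)"
        "\<lambda>S. Max ((\<lambda>M. u (S - M) + v M) ` Pow S)"] by blast
qed

text \<open>Pricing the items of \<open>T\<close> at -1 makes \<open>S \<union> T\<close> demanded
  in \<open>E\<close>, because \<open>u\<close> is monotone. These prices agree in both extensions,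
  so gross substitutes keeps all of \<open>T\<close>, and removing it gives the required
  set.\<close>

lemma gs_endow:
  assumes fin: "finite E" and gs: "gs E u" and TE: "T \<subseteq> E"
    and mono: "\<And>A B. A \<subseteq> B \<Longrightarrow> B \<subseteq> E \<Longrightarrow> u A \<le> u B"
  shows "gs (E - T) (\<lambda>S. u (S \<union> T) - u T)"
proof (rule gsI)
  fix p q :: "'a \<Rightarrow> real" and S
  assume pq: "\<And>i. i \<in> E - T \<Longrightarrow> p i \<le> q i"
    and S: "S \<in> demanded (E - T) (\<lambda>S. u (S \<union> T) - u T) p"
  define ext where "ext r i = (if i \<in> T then - 1 else r i)" for r :: "'a \<Rightarrow> real" and i
  have finT: "finite T" using TE fin finite_subset by blast
  have sum_ext: "sum (ext r) A = sum r (A - T) - real (card (A \<inter> T))" if "A \<subseteq> E"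
    for r :: "'a \<Rightarrow> real" and A
  proof -
    have "finite A" using that fin finite_subset by blast
    then have "sum (ext r) A = sum (ext r) (A \<inter> T) + sum (ext r) (A - T)" by (rule sum.Int_Diff)
    moreover have "sum (ext r) (A - T) = sum r (A - T)" by (intro sum.cong) (auto simp: ext_def)
    moreover have "sum (ext r) (A \<inter> T) = (\<Sum>i\<in>A \<inter> T. - 1)"
      by (intro sum.cong) (auto simp: ext_def)
    ultimately show ?thesis by simp
  qed
  have SE: "S \<subseteq> E - T" using demandedD(1)[OF S] .
  have ST: "S \<union> T \<subseteq> E" "(S \<union> T) - T = S" "(S \<union> T) \<inter> T = T" using SE TE by auto
  have "S \<union> T \<in> demanded E u (ext p)"
  proof (rule demandedI)
    fix A assume A: "A \<subseteq> E"
    have "u A \<le> u ((A - T) \<union> T)" using A TE by (intro mono) auto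
    moreover have "card (A \<inter> T) \<le> card T" using finT by (intro card_mono) auto
    moreover have "u ((A - T) \<union> T) - sum p (A - T) \<le> u (S \<union> T) - sum p S"
      using demandedD(2)[OF S, of "A - T"] A by auto
    ultimately show "u A - sum (ext p) A \<le> u (S \<union> T) - sum (ext p) (S \<union> T)"
      using sum_ext[OF A, of p] sum_ext[OF ST(1), of p] ST by simp
  qed (rule ST)
  then obtain B where B: "B \<in> demanded E u (ext q)" "{i \<in> S \<union> T. ext p i = ext q i} \<subseteq> B"
    by (rule gsD[OF gs, of "ext p" "ext q", rotated]) (use pq in \<open>auto simp: ext_def\<close>)
  have BE: "B \<subseteq> E" using demandedD(1)[OF B(1)] .
  have TB: "T \<subseteq> B" using B(2) by (auto simp: ext_def)
  then have BT: "(B - T) \<union> T = B" "B \<inter> T = T" by auto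
  have "B - T \<in> demanded (E - T) (\<lambda>S. u (S \<union> T) - u T) q"
  proof (rule demandedI)
    fix A assume A: "A \<subseteq> E - T"
    have AT: "A \<union> T \<subseteq> E" "(A \<union> T) - T = A" "(A \<union> T) \<inter> T = T" using A TE by auto
    show "u (A \<union> T) - u T - sum q A \<le> u (B - T \<union> T) - u T - sum q (B - T)"
      using demandedD(2)[OF B(1) AT(1)] sum_ext[OF AT(1), of q] sum_ext[OF BE, of q] AT BT by simp
  qed (use BE in blast)
  moreover have "{i\<in>S. p i = q i} \<subseteq> B - T" using B(2) SE by (auto simp: ext_def)
  ultimately show "\<exists>B\<in>demanded (E - T) (\<lambda>S. u (S \<union> T) - u T) q. {i\<in>S. p i = q i} \<subseteq> B"
    by blast
qed

section \<open>Closure of the gross substitutes valuations\<close>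

lemma GSV_restrictI:
  assumes "E \<subseteq> {1..n}" "f {} = 0" "\<And>S T. S \<subseteq> T \<Longrightarrow> T \<subseteq> E \<Longrightarrow> f S \<le> f T" "gs E f"
  shows "(E, \<lambda>S\<in>Pow E. f S) \<in> GSV n"
proof -
  have "0 \<le> f S" if "S \<subseteq> E" for S using assms(2) assms(3)[of "{}" S] that by simp
  then have "valuation_on E (\<lambda>S\<in>Pow E. f S)"
    using assms(2,3) by (auto simp: valuation_on_def)
  moreover have "gs E (\<lambda>S\<in>Pow E. f S)" using assms(4) gs_cong[of E "\<lambda>S\<in>Pow E. f S" f] by simp
  ultimately show ?thesis using assms(1) by (simp add: GSV_def gross_substitutes_iff_gs)
qed

lemma GSVD:
  assumes "(E, u) \<in> GSV n"
  shows "E \<subseteq> {1..n}" "finite E" "u {} = 0" "gs E u" "u \<in> extensional (Pow E)"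
    "\<And>S T. S \<subseteq> T \<Longrightarrow> T \<subseteq> E \<Longrightarrow> u S \<le> u T" "\<And>S. S \<subseteq> E \<Longrightarrow> 0 \<le> u S"
  using assms
  by (auto simp: GSV_def valuation_on_def gross_substitutes_iff_gs PiE_iff intro: finite_subset)

definition merge_fun ::
  "nat set \<Rightarrow> (nat set \<Rightarrow> real) \<Rightarrow> nat set \<Rightarrow> (nat set \<Rightarrow> real) \<Rightarrow> nat set \<Rightarrow> real" where
  "merge_fun E1 u1 E2 u2 S = Max {u1 T + u2 (S - T) | T. T \<subseteq> S \<inter> E1 \<and> S - T \<subseteq> E2}"

lemma merge_eq: "merge (E1, u1) (E2, u2) = (E1 \<union> E2, \<lambda>S\<in>Pow (E1 \<union> E2). merge_fun E1 u1 E2 u2 S)"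
  by (simp add: merge_fun_def)

lemma finite_merge_values:
  assumes "finite S"
  shows "finite {u1 T + u2 (S - T) | T. T \<subseteq> S \<inter> E1 \<and> S - T \<subseteq> E2}"
proof -
  have "finite ((\<lambda>T. u1 T + u2 (S - T)) ` Pow S)" using assms by simp
  then show ?thesis by (rule rev_finite_subset) auto
qed

lemma merge_fun_ge:
  assumes "finite S" "T \<subseteq> S \<inter> E1" "S - T \<subseteq> E2"
  shows "u1 T + u2 (S - T) \<le> merge_fun E1 u1 E2 u2 S"
  unfolding merge_fun_def using finite_merge_values[OF assms(1)] assms(2,3)
  by (intro Max_ge) auto

lemma merge_fun_attained:
  assumes "finite S" "S \<subseteq> E1 \<union> E2"
  obtains T where "T \<subseteq> S \<inter> E1" "S - T \<subseteq> E2" "merge_fun E1 u1 E2 u2 S = u1 T + u2 (S - T)"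
proof -
  have "u1 (S \<inter> E1) + u2 (S - S \<inter> E1) \<in> {u1 T + u2 (S - T) | T. T \<subseteq> S \<inter> E1 \<and> S - T \<subseteq> E2}"
    using assms(2) by blast
  then have "{u1 T + u2 (S - T) | T. T \<subseteq> S \<inter> E1 \<and> S - T \<subseteq> E2} \<noteq> {}" by blast
  from Max_in[OF finite_merge_values[OF assms(1)] this] show thesis
    using that unfolding merge_fun_def by blast
qed

lemma merge_commute: "merge u v = merge v u"
proof (cases u, cases v)
  fix E1 u1 E2 u2 assume uv: "u = (E1, u1)" "v = (E2, u2)"
  have sub: "{u1 T + u2 (S - T) | T. T \<subseteq> S \<inter> E1 \<and> S - T \<subseteq> E2} \<subseteq>
      {u2 T + u1 (S - T) | T. T \<subseteq> S \<inter> E2 \<and> S - T \<subseteq> E1}" for E1 E2 S and u1 u2 :: "nat set \<Rightarrow> real"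
  proof
    fix z assume "z \<in> {u1 T + u2 (S - T) | T. T \<subseteq> S \<inter> E1 \<and> S - T \<subseteq> E2}"
    then obtain T where T: "z = u1 T + u2 (S - T)" "T \<subseteq> S \<inter> E1" "S - T \<subseteq> E2" by blast
    then have "S - (S - T) = T" by blast
    then have "z = u2 (S - T) + u1 (S - (S - T))" "S - T \<subseteq> S \<inter> E2" "S - (S - T) \<subseteq> E1"
      using T by auto
    then show "z \<in> {u2 T + u1 (S - T) | T. T \<subseteq> S \<inter> E2 \<and> S - T \<subseteq> E1}" by blast
  qed
  have "merge_fun E1 u1 E2 u2 S = merge_fun E2 u2 E1 u1 S" for S
    unfolding merge_fun_def by (intro arg_cong[where f = Max] subset_antisym sub)
  then have "merge_fun E1 u1 E2 u2 = merge_fun E2 u2 E1 u1" by blast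
  then show ?thesis by (simp add: uv merge_eq Un_commute del: merge.simps)
qed

text \<open>After padding with worthless items the merge is a convolution on the common ground set.
  The convolution also admits splits that give a factor items it cannot use, but by monotonicity
  these do not increase the maximum.\<close>

lemma merge_in_GSV:
  assumes "u \<in> GSV n" "v \<in> GSV n"
  shows "merge u v \<in> GSV n"
proof (cases u, cases v)
  fix E1 u1 E2 u2 assume uv: "u = (E1, u1)" "v = (E2, u2)"
  have u1: "(E1, u1) \<in> GSV n" and u2: "(E2, u2) \<in> GSV n" using assms uv by auto
  define E where "E = E1 \<union> E2"
  have finE: "finite E" using GSVD(2)[OF u1] GSVD(2)[OF u2] by (simp add: E_def)
  note finS = finite_subset[OF _ finE]
  have conv: "merge_fun E1 u1 E2 u2 S = Max ((\<lambda>M. u1 ((S - M) \<inter> E1) + u2 (M \<inter> E2)) ` Pow S)"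
    if S: "S \<subseteq> E" for S
  proof (rule antisym)
    obtain T where T: "T \<subseteq> S \<inter> E1" "S - T \<subseteq> E2" "merge_fun E1 u1 E2 u2 S = u1 T + u2 (S - T)"
      using merge_fun_attained finS S unfolding E_def by metis
    have "(S - (S - T)) \<inter> E1 = T" "(S - T) \<inter> E2 = S - T" using T by auto
    then show "merge_fun E1 u1 E2 u2 S \<le> Max ((\<lambda>M. u1 ((S - M) \<inter> E1) + u2 (M \<inter> E2)) ` Pow S)"
      using finS[OF S] T(3) by (intro Max_ge) (auto intro!: image_eqI[of _ _ "S - T"])
  next
    have "u1 ((S - M) \<inter> E1) + u2 (M \<inter> E2) \<le> merge_fun E1 u1 E2 u2 S" if M: "M \<subseteq> S" for M
    proof -
      \<comment> \<open>The item goes to \<open>u2\<close> when \<open>M\<close> assigns it there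
        and \<open>u2\<close> can use it, or when \<open>u1\<close> cannot; neither factor loses a
        usable item.\<close>
      define T where "T = S \<inter> E1 - M \<inter> E2"
      have T: "T \<subseteq> S \<inter> E1" "S - T \<subseteq> E2" using S by (auto simp: T_def E_def)
      have "u1 ((S - M) \<inter> E1) \<le> u1 T" using T by (intro GSVD(6)[OF u1]) (auto simp: T_def)
      moreover have "u2 (M \<inter> E2) \<le> u2 (S - T)"
        using T M by (intro GSVD(6)[OF u2]) (auto simp: T_def)
      ultimately show ?thesis using merge_fun_ge[OF finS[OF S] T, of u1 u2] by linarith
    qed
    then show "Max ((\<lambda>M. u1 ((S - M) \<inter> E1) + u2 (M \<inter> E2)) ` Pow S) \<le> merge_fun E1 u1 E2 u2 S"
      using finS[OF S] by (intro Max.boundedI) auto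
  qed
  have "gs E (\<lambda>S. u1 (S \<inter> E1))" "gs E (\<lambda>S. u2 (S \<inter> E2))"
    by (rule gs_dummy_items[OF finE _ GSVD(4)[OF u1]], simp add: E_def)
      (rule gs_dummy_items[OF finE _ GSVD(4)[OF u2]], simp add: E_def)
  from gs_convolution[OF finE this]
  have "gs E (merge_fun E1 u1 E2 u2)"
    using gs_cong[of E "merge_fun E1 u1 E2 u2", OF conv] by simp
  moreover have "merge_fun E1 u1 E2 u2 {} = 0"
    using GSVD(3)[OF u1] GSVD(3)[OF u2] conv[of "{}"] by simp
  moreover have "merge_fun E1 u1 E2 u2 S \<le> merge_fun E1 u1 E2 u2 S'" if S: "S \<subseteq> S'" "S' \<subseteq> E" for S S'
  proof -
    have SE: "S \<subseteq> E" using S by blast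
    obtain T where T: "T \<subseteq> S \<inter> E1" "S - T \<subseteq> E2" "merge_fun E1 u1 E2 u2 S = u1 T + u2 (S - T)"
      using merge_fun_attained finS SE unfolding E_def by metis
    define T' where "T' = T \<union> ((S' - S) \<inter> E1)"
    have T': "T' \<subseteq> S' \<inter> E1" "S' - T' \<subseteq> E2" using T S by (auto simp: T'_def E_def)
    have "u1 T \<le> u1 T'" using T' by (intro GSVD(6)[OF u1]) (auto simp: T'_def)
    moreover have "u2 (S - T) \<le> u2 (S' - T')"
      using T' S by (intro GSVD(6)[OF u2]) (auto simp: T'_def)
    ultimately show ?thesis using merge_fun_ge[OF finS[OF S(2)] T', of u1 u2] T(3) by linarith
  qed
  moreover have "E \<subseteq> {1..n}" using GSVD(1)[OF u1] GSVD(1)[OF u2] by (simp add: E_def)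
  ultimately have "(E, \<lambda>S\<in>Pow E. merge_fun E1 u1 E2 u2 S) \<in> GSV n" by (intro GSV_restrictI) auto
  then show ?thesis by (simp add: uv merge_eq E_def del: merge.simps)
qed

lemma endow_in_GSV:
  assumes "u \<in> GSV n" "T \<subseteq> fst u"
  shows "endow T u \<in> GSV n"
proof (cases u)
  case (Pair E f)
  then have u: "(E, f) \<in> GSV n" and T: "T \<subseteq> E" using assms by auto
  have "(E - T, \<lambda>S\<in>Pow (E - T). f (S \<union> T) - f T) \<in> GSV n"
  proof (rule GSV_restrictI)
    show "gs (E - T) (\<lambda>S. f (S \<union> T) - f T)"
      using gs_endow[OF GSVD(2,4)[OF u] T] GSVD(6)[OF u] by blast
    fix A B assume AB: "A \<subseteq> B" "B \<subseteq> E - T"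
    then have "f (A \<union> T) \<le> f (B \<union> T)" using T by (intro GSVD(6)[OF u]) auto
    then show "f (A \<union> T) - f T \<le> f (B \<union> T) - f T" by simp
  qed (use GSVD(1)[OF u] in auto)
  then show ?thesis by (simp add: Pair)
qed

section \<open>The generators are gross substitutes valuations\<close>

lemma weighted_ranks_subset_GSV: "weighted_ranks n \<subseteq> GSV n"
proof
  fix u assume "u \<in> weighted_ranks n"
  then obtain E \<I> w where u: "u = weighted_rank E \<I> w" and E: "E \<subseteq> {1..n}" and M: "matroid E \<I>"
    by (auto simp: weighted_ranks_def)
  note finS = finite_subset[OF _ matroidD(1)[OF M]]
  have "(E, \<lambda>S\<in>Pow E. max_weight \<I> w S) \<in> GSV n"
  proof (rule GSV_restrictI[OF E])
    show "gs E (max_weight \<I> w)"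
      using exchange_imp_gs[OF matroidD(1)[OF M] exchange_max_weight[OF M]] .
    show "max_weight \<I> w {} = 0"
      by (rule max_weight_attained[of "{}" \<I> w]) (use matroidD(2)[OF M] in auto)
    fix S T assume ST: "S \<subseteq> T" "T \<subseteq> E"
    then obtain I where "I \<in> \<I>" "I \<subseteq> S" "max_weight \<I> w S = sum w I"
      using max_weight_attained[of S \<I> w] matroidD(2)[OF M] finS by blast
    then show "max_weight \<I> w S \<le> max_weight \<I> w T"
      using max_weight_ge[of T I \<I> w] ST finS by auto
  qed
  then show "u \<in> GSV n" by (simp add: u weighted_rank_def max_weight_def)
qed

lemma color_count_in_GSV:
  fixes g :: "nat \<Rightarrow> real" and c :: "nat \<Rightarrow> 'b"
  assumes E: "E \<subseteq> {1..n}" and g0: "g 0 = 0"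
    and mono: "\<And>k l. k \<le> l \<Longrightarrow> g k \<le> g l"
    and concave: "\<And>k l. k \<le> l \<Longrightarrow> g (Suc l) + g k \<le> g l + g (Suc k)"
  shows "(E, \<lambda>S\<in>Pow E. g (card (c ` S))) \<in> GSV n"
proof (rule GSV_restrictI[OF E])
  have fin: "finite E" using E finite_subset by blast
  show "gs E (\<lambda>S. g (card (c ` S)))"
    using exchange_imp_gs[OF fin exchange_color_count[of E g c, OF fin mono concave]] .
  fix S T assume "S \<subseteq> T" "T \<subseteq> E"
  then show "g (card (c ` S)) \<le> g (card (c ` T))"
    using fin by (intro mono card_mono) (auto intro: finite_subset)
qed (simp add: g0)

lemma partition_valuations_subset_GSV: "partition_valuations n \<subseteq> GSV n"
proof
  fix u assume "u \<in> partition_valuations n"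
  then obtain E \<pi> a b where u: "u = partition_valuation E \<pi> a b" and E: "E \<subseteq> {1..n}"
    and part: "partition_on E \<pi>" and ab: "0 < a" "a < b" "b < 2 * a"
    by (auto simp: partition_valuations_def)
  \<comment> \<open>The colour of an item is the set of blocks containing it, a singleton on
    \<open>E\<close>. Since \<open>a < b < 2 * a\<close>, the increments \<open>a\<close>,
    \<open>b - a\<close>, 0 of \<open>g\<close> are nonnegative and decreasing.\<close>
  define c where "c i = {B\<in>\<pi>. i \<in> B}" for i
  define g where "g k = (if k = 0 then 0 else if k = 1 then a else b)" for k :: nat
  have block: "\<exists>B\<in>\<pi>. c i = {B} \<and> i \<in> B" if "i \<in> E" for i
  proof -
    obtain B where B: "B \<in> \<pi>" "i \<in> B" using partition_onD1[OF part] \<open>i \<in> E\<close> by blast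
    then have "c i = {B}" using disjointD[OF partition_onD2[OF part]] unfolding c_def by blast
    then show ?thesis using B by blast
  qed
  have "(if S = {} then 0 else if \<exists>B\<in>\<pi>. S \<subseteq> B then a else b) = g (card (c ` S))"
    if S: "S \<subseteq> E" for S
  proof (cases "S = {}")
    case False
    then obtain i where i: "i \<in> S" by blast
    have "finite S" using finite_subset[OF S finite_subset[OF E]] by simp
    then have c0: "card (c ` S) \<noteq> 0" using False by simp
    have "(\<exists>B\<in>\<pi>. S \<subseteq> B) \<longleftrightarrow> card (c ` S) = 1"
    proof
      assume "\<exists>B\<in>\<pi>. S \<subseteq> B"
      then obtain B where B: "B \<in> \<pi>" "S \<subseteq> B" by blast
      have "c j = {B}" if "j \<in> S" for j
      proof -
        have "B \<in> c j" using B that by (auto simp: c_def)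
        then show ?thesis using block S that by fastforce
      qed
      then have "c ` S = {{B}}" using False by auto
      then show "card (c ` S) = 1" by simp
    next
      assume "card (c ` S) = 1"
      then obtain C where C: "c ` S = {C}" by (rule card_1_singletonE)
      obtain B where B: "B \<in> \<pi>" "c i = {B}" using block i S by blast
      have "S \<subseteq> B"
      proof
        fix j assume j: "j \<in> S"
        then have "c j = {B}" using C B i by (metis image_eqI singletonD)
        then show "j \<in> B" by (auto simp: c_def)
      qed
      then show "\<exists>B\<in>\<pi>. S \<subseteq> B" using B by blast
    qed
    then show ?thesis using False c0 by (simp add: g_def)
  qed (simp add: g_def)
  then have "u = (E, \<lambda>S\<in>Pow E. g (card (c ` S)))"
    unfolding u partition_valuation_def by (auto intro!: restrict_ext)
  moreover have "(E, \<lambda>S\<in>Pow E. g (card (c ` S))) \<in> GSV n"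
    using ab by (intro color_count_in_GSV[OF E]) (auto simp: g_def)
  ultimately show "u \<in> GSV n" by simp
qed

section \<open>Irreducibility\<close>

text \<open>If \<open>S\<close> is a minimal set of positive value, it is the only demanded set when its items are
  cheap and the others expensive. Making one item of \<open>S\<close> expensive forces the remaining ones,
  which are then worthless, to stay demanded.\<close>

lemma gs_zero_of_singletons:
  fixes u :: "'a set \<Rightarrow> real"
  assumes fin: "finite E" and gs: "gs E u" and u0: "u {} = 0"
    and mono: "\<And>S T. S \<subseteq> T \<Longrightarrow> T \<subseteq> E \<Longrightarrow> u S \<le> u T"
    and single: "\<And>i. i \<in> E \<Longrightarrow> u {i} = 0" and S: "S \<subseteq> E"
  shows "u S = 0"
  using finite_subset[OF S fin] S
proof (induction S rule: finite_psubset_induct)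
  case (psubset S)
  show ?case
  proof (rule ccontr)
    assume "u S \<noteq> 0"
    moreover have "0 \<le> u S" using mono[of "{}" S] psubset.prems u0 by simp
    ultimately have pos: "0 < u S" by simp
    then obtain i where i: "i \<in> S" using u0 by fastforce
    have "S \<noteq> {i}" using single i psubset.prems pos by force
    then obtain j where j: "j \<in> S" "j \<noteq> i" using i by blast
    have uE: "0 \<le> u E" using mono[of "{}" E] u0 by simp
    \<comment> \<open>With this price per item, \<open>S\<close> costs \<open>u S / 2\<close> and
      has positive utility.\<close>
    define e where "e = u S / (2 * real (card S))"
    have cS: "0 < card S" using i psubset.hyps by (simp add: card_gt_0_iff) blast
    have e: "0 < e" using pos cS by (simp add: e_def)
    \<comment> \<open>The price \<open>u E + 1\<close> exceeds every value of \<open>u\<close>, so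
      no set of nonnegative utility contains such an item.\<close>
    define p where "p k = (if k \<in> S then e else u E + 1)" for k
    define q where "q = p(i := max (p i) (u E + 1))"
    have cheap: "k \<notin> T" if T: "T \<subseteq> E" "0 \<le> u T - sum r T" and r: "\<And>l. 0 \<le> r l" "u E + 1 \<le> r k"
      for T k and r :: "'a \<Rightarrow> real"
    proof
      assume "k \<in> T"
      then have "r k \<le> sum r T" using T fin r by (intro member_le_sum) (auto intro: finite_subset)
      moreover have "u T \<le> u E" using mono[OF T(1)] by simp
      ultimately show False using T r by linarith
    qed
    have p0: "0 \<le> p l" and q0: "0 \<le> q l" for l using e uE by (auto simp: p_def q_def)
    obtain T where T: "T \<in> demanded E u p" using demanded_nonempty[OF fin] by blast
    have TE: "T \<subseteq> E" using demandedD(1)[OF T] .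
    have "sum p S = real (card S) * e" by (simp add: p_def)
    also have "\<dots> = u S / 2" using cS by (simp add: e_def)
    finally have Tpos: "0 < u T - sum p T"
      using demandedD(2)[OF T psubset.prems] pos by simp
    have TS: "T \<subseteq> S"
    proof
      fix k assume k: "k \<in> T"
      show "k \<in> S"
      proof (rule ccontr)
        assume "k \<notin> S"
        then have "u E + 1 \<le> p k" by (simp add: p_def)
        from cheap[of T p k, OF TE _ p0 this] k Tpos show False by simp
      qed
    qed
    have "0 \<le> sum p T" using p0 by (intro sum_nonneg) auto
    \<comment> \<open>By induction a proper subset of \<open>S\<close> is worth 0, so its utility
      cannot be positive.\<close>
    then have "T = S" using psubset.IH[of T] TS TE Tpos by fastforce
    then obtain T' where T': "T' \<in> demanded E u q" "{k \<in> S. p k = q k} \<subseteq> T'"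
      by (auto simp: q_def intro: gsD[OF gs _ T, of q])
    have T'E: "T' \<subseteq> E" using demandedD(1)[OF T'(1)] .
    have T'pos: "0 \<le> u T' - sum q T'" using demandedD(2)[OF T'(1), of "{}"] u0 by simp
    have "T' \<subseteq> S - {i}"
    proof
      fix k assume k: "k \<in> T'"
      show "k \<in> S - {i}"
      proof (rule ccontr)
        assume "k \<notin> S - {i}"
        then have "u E + 1 \<le> q k" by (auto simp: p_def q_def)
        from cheap[of T' q k, OF T'E T'pos q0 this] k show False by simp
      qed
    qed
    then have "T' \<subset> S" using i by blast
    then have "u T' = 0" using psubset.IH T'E by blast
    \<comment> \<open>The kept item \<open>j\<close> still costs \<open>e > 0\<close>, while
      \<open>T'\<close> is worth 0; the empty set would be strictly better.\<close>
    moreover have "j \<in> T'" using T'(2) j by (auto simp: q_def)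
    then have "q j \<le> sum q T'" using T'E fin q0 by (intro member_le_sum) (auto intro: finite_subset)
    moreover have "q j = e" using j by (simp add: q_def p_def)
    ultimately show False using T'pos e by simp
  qed
qed

lemma irreducible_valuationI:
  assumes v: "(E, f) \<in> GSV n" and a: "\<And>i. i \<in> E \<Longrightarrow> f {i} = a" and a0: "0 < a"
    and pair: "\<And>i j. i \<in> E \<Longrightarrow> j \<in> E \<Longrightarrow> i \<noteq> j \<Longrightarrow> f {i, j} < 2 * a"
    and parallel: "\<And>j. j \<in> E \<Longrightarrow> \<exists>i\<in>E. i \<noteq> j \<and> f {i, j} = a"
  shows "irreducible_valuation n (E, f)"
proof -
  have absorb: "(E1, u1) = (E, f)"
    if u1: "(E1, u1) \<in> GSV n" and u2: "(E2, u2) \<in> GSV n"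
      and eq: "(E, f) = merge (E1, u1) (E2, u2)"
      and all: "\<And>i. i \<in> E \<Longrightarrow> i \<in> E1 \<and> u1 {i} = a" for E1 u1 E2 u2
  proof -
    have E: "E = E1 \<union> E2" and f: "\<And>S. S \<subseteq> E \<Longrightarrow> f S = merge_fun E1 u1 E2 u2 S"
      using eq unfolding merge_eq by auto
    have E1: "E1 = E" using E all by blast
    \<comment> \<open>For a parallel partner \<open>i\<close> of \<open>j\<close>, the split of the
      pair gives \<open>a + u2 {j} \<le> f {i, j} = a\<close>.\<close>
    have "u2 {j} = 0" if j: "j \<in> E2" for j
    proof -
      have jE: "j \<in> E" using j E by blast
      then obtain i where i: "i \<in> E" "i \<noteq> j" "f {i, j} = a" using parallel by blast
      have "{i, j} - {i} = {j}" using i by blast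
      then have "u1 {i} + u2 {j} \<le> f {i, j}"
        using merge_fun_ge[of "{i, j}" "{i}" E1 E2 u1 u2] f[of "{i, j}"] i jE j E1 by simp
      then show ?thesis using all[OF i(1)] i GSVD(7)[OF u2, of "{j}"] j by simp
    qed
    then have zero: "u2 S = 0" if "S \<subseteq> E2" for S
      using gs_zero_of_singletons[OF GSVD(2,4,3,6)[OF u2] _ that] by blast
    have "f S = u1 S" if S: "S \<subseteq> E" for S
    proof (rule antisym)
      have finS: "finite S" using S GSVD(2)[OF v] finite_subset by blast
      obtain T where T: "T \<subseteq> S \<inter> E1" "S - T \<subseteq> E2" "merge_fun E1 u1 E2 u2 S = u1 T + u2 (S - T)"
        using merge_fun_attained[OF finS] S E by metis
      then show "f S \<le> u1 S" using zero f[OF S] GSVD(6)[OF u1, of T S] S E1 by simp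
      show "u1 S \<le> f S"
        using merge_fun_ge[OF finS, of S E1 E2 u1 u2] f[OF S] S E1 GSVD(3)[OF u2] by simp
    qed
    then have "f = u1"
      using GSVD(5)[OF v] GSVD(5)[OF u1] E1 by (intro extensionalityI) auto
    then show ?thesis using E1 by simp
  qed
  have "(E, f) = (E1, u1) \<or> (E, f) = (E2, u2)"
    if u1: "(E1, u1) \<in> GSV n" and u2: "(E2, u2) \<in> GSV n"
      and eq: "(E, f) = merge (E1, u1) (E2, u2)" for E1 u1 E2 u2
  proof -
    have E: "E = E1 \<union> E2" and f: "\<And>S. S \<subseteq> E \<Longrightarrow> f S = merge_fun E1 u1 E2 u2 S"
      using eq unfolding merge_eq by auto
    have split: "(i \<in> E1 \<and> u1 {i} = a) \<or> (i \<in> E2 \<and> u2 {i} = a)" if i: "i \<in> E" for i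
    proof -
      obtain T where T: "T \<subseteq> {i} \<inter> E1" "{i} - T \<subseteq> E2"
        "merge_fun E1 u1 E2 u2 {i} = u1 T + u2 ({i} - T)"
        using merge_fun_attained[of "{i}" E1 E2 u1 u2] i E by auto
      have "f {i} = u1 T + u2 ({i} - T)" using f[of "{i}"] i T by simp
      then have sum_a: "u1 T + u2 ({i} - T) = a" using a[OF i] by simp
      have "T = {} \<or> T = {i}" using T by blast
      then show ?thesis
      proof
        assume "T = {}"
        then show ?thesis using sum_a T(2) GSVD(3)[OF u1] by simp
      next
        assume "T = {i}"
        then show ?thesis using sum_a T(1) GSVD(3)[OF u2] by simp
      qed
    qed
    \<comment> \<open>Distinct items valued \<open>a\<close> by different factors would make the
      pair worth at least \<open>2 * a\<close>.\<close>
    have one: "i = j" if "i \<in> E1" "u1 {i} = a" "j \<in> E2" "u2 {j} = a" for i j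
    proof (rule ccontr)
      assume "i \<noteq> j"
      then have "{i, j} - {i} = {j}" by blast
      then have "u1 {i} + u2 {j} \<le> f {i, j}"
        using merge_fun_ge[of "{i, j}" "{i}" E1 E2 u1 u2] f[of "{i, j}"] that E by simp
      then show False using pair[of i j] that E \<open>i \<noteq> j\<close> by auto
    qed
    \<comment> \<open>An item valued \<open>a\<close> by \<open>u2\<close> alone excludes, by
      \<open>one\<close>, every item valued \<open>a\<close> by \<open>u1\<close>; then
      \<open>u2\<close> covers all of \<open>E\<close>.\<close>
    have "(\<forall>i\<in>E. i \<in> E1 \<and> u1 {i} = a) \<or> (\<forall>i\<in>E. i \<in> E2 \<and> u2 {i} = a)"
      using split one parallel by metis
    then show ?thesis
      using absorb[OF u1 u2 eq] absorb[OF u2 u1] eq merge_commute by metis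
  qed
  then show ?thesis using v unfolding irreducible_valuation_def by fast
qed

text \<open>On the full ground set the only endowment operation producing \<open>v\<close> is the trivial one, so
  deleting \<open>v\<close> from \<open>GSV n\<close> leaves a closed family.\<close>

lemma irreducible_not_generated:
  assumes irr: "irreducible_valuation n v" and full: "fst v = {1..n}"
    and "v \<notin> weighted_ranks n" "v \<notin> partition_valuations n"
  shows "v \<notin> generated_valuations n"
proof -
  let ?X = "GSV n - {v}"
  have "closed_under_merging ?X"
    unfolding closed_under_merging_def
  proof (intro ballI)
    fix u u' assume u: "u \<in> ?X" "u' \<in> ?X"
    then have "u \<in> GSV n" "u' \<in> GSV n" "v \<noteq> u" "v \<noteq> u'" by auto
    then have "merge u u' \<noteq> v" using irr unfolding irreducible_valuation_def by metis
    then show "merge u u' \<in> ?X" using merge_in_GSV u by blast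
  qed
  moreover have "closed_under_endowment ?X"
    unfolding closed_under_endowment_def
  proof (intro ballI allI impI)
    fix u T assume u: "u \<in> ?X" and T: "T \<subseteq> fst u"
    have "endow T u \<noteq> v"
    proof
      assume eq: "endow T u = v"
      obtain E f where uE: "u = (E, f)" by fastforce
      then have f: "(E, f) \<in> GSV n" using u by simp
      have "fst (endow T u) = E - T" by (simp add: uE)
      then have "E - T = {1..n}" by (simp only: eq full)
      then have "T = {}" "E = {1..n}" using T uE GSVD(1)[OF f] by auto
      then have "endow T u = (E, \<lambda>S\<in>Pow E. f S)" using GSVD(3)[OF f] uE by simp
      also have "\<dots> = u" using uE GSVD(5)[OF f] by (simp add: extensional_restrict)
      finally show False using eq u by simp
    qed
    then show "endow T u \<in> ?X" using endow_in_GSV u T by blast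
  qed
  moreover have "weighted_ranks n \<subseteq> ?X" "partition_valuations n \<subseteq> ?X"
    using weighted_ranks_subset_GSV partition_valuations_subset_GSV assms(3,4) by blast+
  ultimately show ?thesis unfolding generated_valuations_def by blast
qed

section \<open>The three-class example\<close>

theorem theorem1p4:
  fixes n :: nat
  assumes "n \<ge> 6"
  shows "\<exists>v\<in>GSV n. irreducible_valuation n v \<and> v \<notin> generated_valuations n"
proof -
  define c :: "nat \<Rightarrow> nat" where "c i = (if i \<le> 2 then 0 else if i \<le> 4 then 1 else 2)" for i
  \<comment> \<open>The decreasing increments 3, 2, 1 give concavity, and 5 < 2 * 3 bounds the
    pairs. That 5 is no multiple of 3 excludes weighted ranks; three distinct positive values
    exclude partition valuations.\<close>
  define g :: "nat \<Rightarrow> real" where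
    "g k = (if k = 0 then 0 else if k = 1 then 3 else if k = 2 then 5 else 6)" for k
  define f where "f = (\<lambda>S\<in>Pow {1..n}. g (card (c ` S)))"
  have f: "f S = g (card (c ` S))" if "S \<subseteq> {1..n}" for S using that by (simp add: f_def)
  have v: "({1..n}, f) \<in> GSV n"
    unfolding f_def by (intro color_count_in_GSV) (auto simp: g_def)
  have single: "f {i} = 3" if "i \<in> {1..n}" for i using f[of "{i}"] that by (simp add: g_def)
  have irr: "irreducible_valuation n ({1..n}, f)"
  proof (rule irreducible_valuationI[OF v single])
    fix i j assume "i \<in> {1..n}" "j \<in> {1..n}"
    then have "f {i, j} = g (card {c i, c j})" using f[of "{i, j}"] by simp
    also have "\<dots> < 6" by (cases "c i = c j") (auto simp: g_def)
    finally show "f {i, j} < 2 * 3" by simp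
  next
    fix j assume j: "j \<in> {1..n}"
    \<comment> \<open>A partner from the class of \<open>j\<close>. The bound
      \<open>n \<ge> 6\<close> provides item 6 as a partner for item 5.\<close>
    define i :: nat where
      "i = (if j = 1 then 2 else if j \<le> 2 then 1 else if j = 3 then 4 else if j \<le> 4 then 3
        else if j = 5 then 6 else 5)"
    have "i \<in> {1..n}" "i \<noteq> j" "c i = c j" using j assms by (auto simp: i_def c_def)
    moreover from this have "f {i, j} = 3" using f[of "{i, j}"] j by (simp add: g_def)
    ultimately show "\<exists>i\<in>{1..n}. i \<noteq> j \<and> f {i, j} = 3" by blast
  qed auto
  have f13: "f {1, 3} = 5" and f135: "f {1, 3, 5} = 6"
    using f[of "{1, 3}"] f[of "{1, 3, 5}"] assms by (auto simp: c_def g_def)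
  have "({1..n}, f) \<notin> weighted_ranks n"
  proof
    assume "({1..n}, f) \<in> weighted_ranks n"
    then obtain \<I> w where M: "matroid {1..n} \<I>"
      and fw: "f = (\<lambda>T\<in>Pow {1..n}. max_weight \<I> w T)"
      by (auto simp: weighted_ranks_def weighted_rank_def max_weight_def)
    \<comment> \<open>Singletons force every weight to be 3, so a rank of \<open>{1, 3}\<close>
      would be a multiple of 3.\<close>
    have w: "w i = 3" if i: "i \<in> {1..n}" for i
    proof -
      obtain I where I: "I \<subseteq> {i}" "max_weight \<I> w {i} = sum w I"
        using max_weight_attained[of "{i}" \<I> w] matroidD(2)[OF M] by blast
      have "sum w I = 3" using single[OF i] i I(2) by (simp add: fw)
      moreover from this have "I \<noteq> {}" by auto
      then have "I = {i}" using I(1) by blast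
      ultimately show ?thesis by simp
    qed
    obtain I where I: "I \<subseteq> {1, 3}" "max_weight \<I> w {1, 3} = sum w I"
      using max_weight_attained[of "{1, 3}" \<I> w] matroidD(2)[OF M] by blast
    have "sum w I = (\<Sum>i\<in>I. 3)" using w I(1) assms by (intro sum.cong) auto
    then have "real (card I) * 3 = 5" using I(2) f13 assms by (simp add: fw)
    then have "real (card I * 3) = real 5" by simp
    then have "card I * 3 = 5" by (simp only: of_nat_eq_iff)
    then show False by presburger
  qed
  moreover have "({1..n}, f) \<notin> partition_valuations n"
  proof
    assume "({1..n}, f) \<in> partition_valuations n"
    then obtain \<pi> a b where "f = (\<lambda>I\<in>Pow {1..n}. if I = {} then 0 else if \<exists>B\<in>\<pi>. I \<subseteq> B then a else b)"
      by (auto simp: partition_valuations_def partition_valuation_def)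
    then have two: "f S = a \<or> f S = b" if "S \<subseteq> {1..n}" "S \<noteq> {}" for S using that by auto
    show False
      using two[of "{1}"] two[of "{1, 3}"] two[of "{1, 3, 5}"] single[of 1] f13 f135 assms by auto
  qed
  ultimately show ?thesis using v irr irreducible_not_generated[OF irr] by auto
qed

end
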